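(* Assume the Bounded Min-Plus Product Hypothesis. Then for every constant $\gamma\in[0,1]$, with $d=n^\gamma\ge 2$, APSP on $n$-node (directed or undirected) graphs whose edge weights take at most $d$ distinct values — and hence also $d$-Weights APSP — cannot be solved in time $O(\sqrt d\, n^{2.5-\epsilon})$ for any constant $\epsilon>0$.
   Context: Model: word-RAM with $O(\log n)$-bit words, integer weights polynomially bounded in $n$. For integers, the $(n_1,n_2,n_3\mid U)$-Min-Plus Product problem is: given an $n_1\times n_2$ integer matrix $A$ and an $n_2\times n_3$ integer matrix $B$ with all entries bounded by $U$ in absolute value, compute $C[i,j]=\min_k (A[i,k]+B[k,j])$. Bounded Min-Plus Product Hypothesis: for every $\gamma\in[1/2,1]$, $(n,n^\gamma,n\mid n^\gamma)$-Min-Plus Product cannot be solved in time $O(n^{2+\gamma-\epsilon})$ for any constant $\epsilon>0$. $d$-Weights APSP: given a directed edge-weighted $n$-node graph in which each node's outgoing edges carry at most $d$ distinct weights, compute all pairwise distances. *)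

theory Defs
  imports
    Complex_Main
    "HOL-Library.Extended_Real"
    "Jordan_Normal_Form.Matrix"
    "Graph_Theory.Pair_Digraph"
    "Graph_Theory.Shortest_Path"
begin

section \<open>Word-RAM\<close>

text \<open>
  A deterministic unit-cost RAM with a fixed number of registers (those occurring in the program)
  and an indirectly addressed memory. Control flow is structured rather than by jumps; the two
  simulate each other with constant-factor overhead.

  Every value produced must lie strictly between \<open>-W\<close> and \<open>W\<close>, where \<open>W\<close> is the word bound, and
  an overflowing instruction gets stuck. Running times below only count runs that terminate
  without getting stuck, with \<open>W = (n + 2) ^ c\<close> for a constant \<open>c\<close> that may depend on the program,
  that is, with words of \<open>O(log n)\<close> bits. (Wrap-around arithmetic is obtained by doubling \<open>c\<close> and
  reducing explicitly.)
\<close>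

type_synonym reg = nat

datatype binop = Add | Sub | Mul | Div | Mod | BitAnd | BitOr | BitXor | ShiftL | ShiftR

fun eval_binop :: "binop \<Rightarrow> int \<Rightarrow> int \<Rightarrow> int" where
  "eval_binop Add x y = x + y"
| "eval_binop Sub x y = x - y"
| "eval_binop Mul x y = x * y"
| "eval_binop Div x y = x div y"
| "eval_binop Mod x y = x mod y"
| "eval_binop BitAnd x y = and x y"
| "eval_binop BitOr x y = or x y"
| "eval_binop BitXor x y = xor x y"
| "eval_binop ShiftL x y = push_bit (nat y) x"
| "eval_binop ShiftR x y = drop_bit (nat y) x"

datatype test = Less reg reg | Equal reg reg

datatype com =
    Skip
  | Const reg int
  | Op binop reg reg reg
  | Load reg reg
  | Store reg reg
  | Seq com com
  | If test com com
  | While test com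

record state =
  regs :: "reg \<Rightarrow> int"
  mem :: "nat \<Rightarrow> int"

fun eval_test :: "test \<Rightarrow> state \<Rightarrow> bool" where
  "eval_test (Less a b) s \<longleftrightarrow> regs s a < regs s b"
| "eval_test (Equal a b) s \<longleftrightarrow> regs s a = regs s b"

text \<open>\<open>exec W P s t s'\<close>: started in \<open>s\<close>, the program \<open>P\<close> halts in \<open>s'\<close> after exactly \<open>t\<close> steps.\<close>

inductive exec :: "int \<Rightarrow> com \<Rightarrow> state \<Rightarrow> nat \<Rightarrow> state \<Rightarrow> bool" for W :: int where
  Skip: "exec W Skip s 1 s"
| Const: "\<bar>v\<bar> < W \<Longrightarrow> exec W (Const r v) s 1 (s\<lparr>regs := (regs s)(r := v)\<rparr>)"
| Op: "v = eval_binop f (regs s a) (regs s b) \<Longrightarrow> \<bar>v\<bar> < W \<Longrightarrow>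
    exec W (Op f r a b) s 1 (s\<lparr>regs := (regs s)(r := v)\<rparr>)"
| Load: "0 \<le> regs s a \<Longrightarrow> v = mem s (nat (regs s a)) \<Longrightarrow> \<bar>v\<bar> < W \<Longrightarrow>
    exec W (Load r a) s 1 (s\<lparr>regs := (regs s)(r := v)\<rparr>)"
| Store: "0 \<le> regs s a \<Longrightarrow>
    exec W (Store a r) s 1 (s\<lparr>mem := (mem s)(nat (regs s a) := regs s r)\<rparr>)"
| Seq: "exec W P s t s' \<Longrightarrow> exec W Q s' t' s'' \<Longrightarrow> exec W (Seq P Q) s (t + t') s''"
| IfTrue: "eval_test b s \<Longrightarrow> exec W P s t s' \<Longrightarrow> exec W (If b P Q) s (Suc t) s'"
| IfFalse: "\<not> eval_test b s \<Longrightarrow> exec W Q s t s' \<Longrightarrow> exec W (If b P Q) s (Suc t) s'"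
| WhileFalse: "\<not> eval_test b s \<Longrightarrow> exec W (While b P) s 1 s"
| WhileTrue: "eval_test b s \<Longrightarrow> exec W P s t s' \<Longrightarrow> exec W (While b P) s' t' s'' \<Longrightarrow>
    exec W (While b P) s (Suc (t + t')) s''"

lemma exec_deterministic:
  "exec W P s t s' \<Longrightarrow> exec W P s u s'' \<Longrightarrow> u = t \<and> s'' = s'"
proof (induction arbitrary: u s'' rule: exec.induct)
  case (Seq P s t s' Q t' s3)
  from Seq.prems show ?case by (cases rule: exec.cases) (use Seq.IH in blast)+
next
  case (WhileTrue b s P t s' t' s3)
  from WhileTrue.prems show ?case
    by (cases rule: exec.cases) (use WhileTrue.hyps WhileTrue.IH in blast)+
qed (erule exec.cases; auto)+

definition init_state :: "int list \<Rightarrow> state" where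
  "init_state xs = \<lparr>regs = (\<lambda>_. 0), mem = (\<lambda>a. if a < length xs then xs ! a else 0)\<rparr>"

text \<open>
  A problem is given by its instances of size \<open>n\<close>, the encoding of an instance as the initial
  memory contents, and the predicate saying that the final memory holds a correct answer.
\<close>

definition solvable_in_time ::
  "(nat \<Rightarrow> 'a set) \<Rightarrow> ('a \<Rightarrow> int list) \<Rightarrow> ('a \<Rightarrow> (nat \<Rightarrow> int) \<Rightarrow> bool) \<Rightarrow> (nat \<Rightarrow> real) \<Rightarrow> bool"
where
  "solvable_in_time inst inp correct T \<longleftrightarrow>
    (\<exists>P c. \<exists>C::real. \<forall>n\<ge>1. \<forall>x\<in>inst n. \<exists>t s.
      exec ((int n + 2) ^ c) P (init_state (inp x)) t s \<and>
      real t \<le> C * T n \<and> correct x (mem s))"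

section \<open>Min-plus product\<close>

definition min_plus_product :: "int mat \<Rightarrow> int mat \<Rightarrow> int mat" where
  "min_plus_product A B = mat (dim_row A) (dim_col B)
     (\<lambda>(i, j). Min ((\<lambda>k. A $$ (i, k) + B $$ (k, j)) ` {..<dim_col A}))"

definition min_plus_instances :: "nat \<Rightarrow> nat \<Rightarrow> nat \<Rightarrow> real \<Rightarrow> (int mat \<times> int mat) set" where
  "min_plus_instances n1 n2 n3 U = {(A, B).
     A \<in> carrier_mat n1 n2 \<and> B \<in> carrier_mat n2 n3 \<and>
     (\<forall>i<n1. \<forall>k<n2. real_of_int \<bar>A $$ (i, k)\<bar> \<le> U) \<and>
     (\<forall>k<n2. \<forall>j<n3. real_of_int \<bar>B $$ (k, j)\<bar> \<le> U)}"

definition row_major :: "int mat \<Rightarrow> int list" where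
  "row_major A = concat (map (\<lambda>i. map (\<lambda>j. A $$ (i, j)) [0..<dim_col A]) [0..<dim_row A])"

fun min_plus_input :: "int mat \<times> int mat \<Rightarrow> int list" where
  "min_plus_input (A, B) =
     [int (dim_row A), int (dim_col A), int (dim_col B)] @ row_major A @ row_major B"

fun min_plus_correct :: "int mat \<times> int mat \<Rightarrow> (nat \<Rightarrow> int) \<Rightarrow> bool" where
  "min_plus_correct (A, B) M \<longleftrightarrow> (\<forall>i<dim_row A. \<forall>j<dim_col B.
     M (i * dim_col B + j) = min_plus_product A B $$ (i, j))"

definition bounded_min_plus_hypothesis :: bool where
  "bounded_min_plus_hypothesis \<longleftrightarrow>
    (\<forall>\<gamma>\<in>{1/2..1::real}. \<forall>\<epsilon>>0.
      \<not> solvable_in_time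
          (\<lambda>n. min_plus_instances n (nat \<lfloor>real n powr \<gamma>\<rfloor>) n (real n powr \<gamma>))
          min_plus_input min_plus_correct
          (\<lambda>n. real n powr (2 + \<gamma> - \<epsilon>)))"

section \<open>All-pairs shortest paths\<close>

type_synonym wgraph = "nat pair_pre_digraph \<times> (nat \<times> nat \<Rightarrow> int)"

abbreviation distance :: "nat pair_pre_digraph \<Rightarrow> (nat \<times> nat \<Rightarrow> int) \<Rightarrow> nat \<Rightarrow> nat \<Rightarrow> ereal" where
  "distance G w u v \<equiv> wf_digraph.\<mu> (with_proj G) (\<lambda>e. real_of_int (w e)) u v"

definition no_negative_cycle :: "nat pair_pre_digraph \<Rightarrow> (nat \<times> nat \<Rightarrow> int) \<Rightarrow> bool" where
  "no_negative_cycle G w \<longleftrightarrow>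
    (\<forall>u p. pre_digraph.awalk (with_proj G) u p u \<longrightarrow>
       0 \<le> wf_digraph.awalk_cost (\<lambda>e. real_of_int (w e)) p)"

definition directed_graphs :: "nat \<Rightarrow> wgraph set" where
  "directed_graphs n = {(G, w). pair_digraph G \<and> pverts G = {..<n} \<and> no_negative_cycle G w}"

text \<open>An undirected edge is a pair of opposite arcs of equal weight.\<close>

definition undirected_graphs :: "nat \<Rightarrow> wgraph set" where
  "undirected_graphs n = {(G, w) \<in> directed_graphs n.
     pair_graph G \<and> (\<forall>(u, v)\<in>parcs G. w (u, v) = w (v, u))}"

definition few_weights :: "real \<Rightarrow> wgraph set" where
  "few_weights d = {(G, w). real (card (w ` parcs G)) \<le> d}"

definition few_weights_per_node :: "real \<Rightarrow> wgraph set" where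
  "few_weights_per_node d =
     {(G, w). \<forall>u\<in>pverts G. real (card (w ` out_arcs (with_proj G) u)) \<le> d}"

text \<open>
  The input is the number of nodes followed by the weighted adjacency matrix, the output is the
  distance matrix. An entry takes two words: \<open>1, x\<close> for the number \<open>x\<close>, and \<open>0, _\<close> for a missing
  arc or an infinite distance.
\<close>

fun apsp_input :: "wgraph \<Rightarrow> int list" where
  "apsp_input (G, w) = (let n = card (pverts G) in
     int n # concat (map (\<lambda>u. concat (map (\<lambda>v.
       if (u, v) \<in> parcs G then [1, w (u, v)] else [0, 0]) [0..<n])) [0..<n]))"

definition decode_distance :: "int \<Rightarrow> int \<Rightarrow> ereal \<Rightarrow> bool" where
  "decode_distance b x \<delta> \<longleftrightarrow>
     b = 1 \<and> \<delta> = ereal (real_of_int x) \<or> b = 0 \<and> \<delta> = \<infinity>"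

fun apsp_correct :: "wgraph \<Rightarrow> (nat \<Rightarrow> int) \<Rightarrow> bool" where
  "apsp_correct (G, w) M \<longleftrightarrow> (let n = card (pverts G) in
     \<forall>u<n. \<forall>v<n.
       decode_distance (M (2 * (u * n + v))) (M (2 * (u * n + v) + 1)) (distance G w u v))"

text \<open>
  Weights are polynomially bounded: for every constant \<open>c\<close> there must be an algorithm for weights
  of absolute value at most \<open>n ^ c\<close>.
\<close>

definition apsp_solvable_in_time :: "(nat \<Rightarrow> wgraph set) \<Rightarrow> (nat \<Rightarrow> real) \<Rightarrow> bool" where
  "apsp_solvable_in_time \<G> T \<longleftrightarrow>
    (\<forall>c. solvable_in_time
       (\<lambda>n. {(G, w) \<in> \<G> n. \<forall>e\<in>parcs G. \<bar>w e\<bar> \<le> int n ^ c}) apsp_input apsp_correct T)"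

text \<open>
  The parameter \<open>d = n\<^sup>\<gamma> \<ge> 2\<close>. The maximum matters for \<open>\<gamma> = 0\<close>, where it gives \<open>d = 2\<close>;
  for \<open>\<gamma> > 0\<close> it affects only finitely many \<open>n\<close>.
\<close>

definition num_weights :: "real \<Rightarrow> nat \<Rightarrow> real" where
  "num_weights \<gamma> n = max 2 (real n powr \<gamma>)"

end

theory Submission
  imports Defs
begin

text \<open>
  With \<open>\<beta> = (1 + \<gamma>) / 2\<close>, a min-plus product with inner dimension \<open>K = n\<^sup>\<beta>\<close> and entries of size at most
  \<open>K\<close> is reduced to shortest paths in one undirected graph with \<open>O(n)\<close> vertices and at most
  \<open>D + 1 \<le> max 2 n\<^sup>\<gamma>\<close> distinct weights, where \<open>D\<close> is about \<open>K\<^sup>2 / n\<close>. Each inner index \<open>k\<close> becomes a path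
  with about \<open>K / D\<close> edges of weight \<open>D\<close> on either side of its midpoint. An entry \<open>a * D + b\<close> with
  \<open>b < D\<close> is an edge of weight \<open>M + b\<close> to the vertex at distance \<open>a\<close> from the midpoint, rows attaching on
  one side and columns on the other. The offset \<open>M\<close> is so large that a shortest path from a row to a
  column uses only two such edges, hence runs along a single chain and costs \<open>2 * M\<close> plus the sum of
  the two entries. All chains together have \<open>O(K\<^sup>2 / D) = O(n)\<close> vertices. This graph lies in all three classes
  of the theorem, and the \<open>O(n\<^sup>2)\<close> overhead of the reduction is below \<open>n\<^bsup>2 + \<beta> - \<epsilon>\<^esup>\<close> for
  \<open>\<epsilon> \<le> 1 / 2 \<le> \<beta>\<close>.
\<close>

section \<open>Programs with expressions on the word-RAM\<close>

text \<open>The simplifier rewrites the step count \<open>1\<close> to \<open>Suc 0\<close>; in this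
  form the rules still apply as introduction rules after simplification.\<close>

lemmas exec_unit =
  exec.Skip[unfolded One_nat_def] exec.Const[unfolded One_nat_def] exec.Op[unfolded One_nat_def]
  exec.Load[unfolded One_nat_def] exec.Store[unfolded One_nat_def]
  exec.WhileFalse[unfolded One_nat_def]

section \<open>Runs do not depend on registers outside the program\<close>

definition agree :: "nat \<Rightarrow> state \<Rightarrow> state \<Rightarrow> bool" where
  "agree Z s s' \<longleftrightarrow> (\<forall>r<Z. regs s' r = regs s r) \<and> mem s' = mem s"

fun test_regs :: "test \<Rightarrow> reg set" where
  "test_regs (Less a b) = {a, b}"
| "test_regs (Equal a b) = {a, b}"

fun com_regs :: "com \<Rightarrow> reg set" where
  "com_regs Skip = {}"
| "com_regs (Const r v) = {r}"
| "com_regs (Op f r a b) = {r, a, b}"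
| "com_regs (Load r a) = {r, a}"
| "com_regs (Store a r) = {a, r}"
| "com_regs (Seq P Q) = com_regs P \<union> com_regs Q"
| "com_regs (If b P Q) = test_regs b \<union> com_regs P \<union> com_regs Q"
| "com_regs (While b P) = test_regs b \<union> com_regs P"

lemma finite_com_regs: "finite (com_regs P)"
proof (induction P)
  case (If b P Q) then show ?case by (cases b) auto
next
  case (While b P) then show ?case by (cases b) auto
qed auto

text \<open>A larger word bound only relaxes the overflow conditions. This lets an algorithm on the
  larger graph share the word size of the reduction around it.\<close>

lemma exec_word_bound_mono:
  assumes "exec W P s t s'" "W \<le> W'"
  shows "exec W' P s t s'"
  using assms by (induction rule: exec.induct) (metis exec.intros order.strict_trans2)+

lemma eval_test_agree:
  "agree Z s s1 \<Longrightarrow> test_regs b \<subseteq> {..<Z} \<Longrightarrow> eval_test b s1 = eval_test b s"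
  by (cases b) (auto simp: agree_def)

text \<open>A program neither reads nor changes registers that do not occur in it. The reduction can
  thus keep its own data above the registers of an APSP algorithm while that algorithm runs.\<close>

lemma exec_frame:
  assumes "exec W P s t s'" "com_regs P \<subseteq> {..<Z}" "agree Z s s1"
  shows "\<exists>s1'. exec W P s1 t s1' \<and> agree Z s' s1' \<and> (\<forall>r\<ge>Z. regs s1' r = regs s1 r)"
  using assms
proof (induction arbitrary: s1 rule: exec.induct)
  case (Skip s) then show ?case by (blast intro: exec.Skip)
next
  case (Const v r s)
  then show ?case
    by (intro exI[of _ "s1\<lparr>regs := (regs s1)(r := v)\<rparr>"]) (auto intro!: exec_unit simp: agree_def)
next
  case (Op v f s a b r)
  then show ?case
    by (intro exI[of _ "s1\<lparr>regs := (regs s1)(r := v)\<rparr>"]) (auto intro!: exec_unit simp: agree_def)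
next
  case (Load s a v r)
  then show ?case
    by (intro exI[of _ "s1\<lparr>regs := (regs s1)(r := v)\<rparr>"]) (auto intro!: exec_unit simp: agree_def)
next
  case (Store s a r)
  then have "regs s1 a = regs s a" "regs s1 r = regs s r" by (auto simp: agree_def)
  with Store exec.Store[of s1 a W r] show ?case
    by (intro exI[of _ "s1\<lparr>mem := (mem s1)(nat (regs s1 a) := regs s1 r)\<rparr>"])
      (auto simp: agree_def)
next
  case (Seq P s t s' Q t' s'')
  then obtain s2 where "exec W P s1 t s2" "agree Z s' s2" "\<forall>r\<ge>Z. regs s2 r = regs s1 r"
    by (metis Un_subset_iff com_regs.simps(6))
  moreover from this Seq obtain s3 where
    "exec W Q s2 t' s3" "agree Z s'' s3" "\<forall>r\<ge>Z. regs s3 r = regs s2 r"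
    by (metis Un_subset_iff com_regs.simps(6))
  ultimately show ?case by (metis exec.Seq)
next
  case (IfTrue b s P t s' Q)
  then obtain s2 where "exec W P s1 t s2" "agree Z s' s2" "\<forall>r\<ge>Z. regs s2 r = regs s1 r"
    by (metis Un_subset_iff com_regs.simps(7))
  moreover have "eval_test b s1" using IfTrue eval_test_agree[of Z s s1 b] by auto
  ultimately show ?case by (metis exec.IfTrue)
next
  case (IfFalse b s Q t s' P)
  then obtain s2 where "exec W Q s1 t s2" "agree Z s' s2" "\<forall>r\<ge>Z. regs s2 r = regs s1 r"
    by (metis Un_subset_iff com_regs.simps(7))
  moreover have "\<not> eval_test b s1" using IfFalse eval_test_agree[of Z s s1 b] by auto
  ultimately show ?case by (metis exec.IfFalse)
next
  case (WhileFalse b s P)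
  then have "\<not> eval_test b s1" using eval_test_agree[of Z s s1 b] by auto
  with WhileFalse show ?case by (metis exec.WhileFalse)
next
  case (WhileTrue b s P t s' t' s'')
  then obtain s2 where "exec W P s1 t s2" "agree Z s' s2" "\<forall>r\<ge>Z. regs s2 r = regs s1 r"
    by (metis Un_subset_iff com_regs.simps(8))
  moreover from this WhileTrue obtain s3 where
    "exec W (While b P) s2 t' s3" "agree Z s'' s3" "\<forall>r\<ge>Z. regs s3 r = regs s2 r"
    by metis
  moreover have "eval_test b s1" using WhileTrue eval_test_agree[of Z s s1 b] by auto
  ultimately show ?case by (metis exec.WhileTrue)
qed

text \<open>The time is an upper bound, not exact, so that branches of different cost and all
  iterations of a loop can share one bound.\<close>

definition runs :: "int \<Rightarrow> com \<Rightarrow> state \<Rightarrow> nat \<Rightarrow> (state \<Rightarrow> bool) \<Rightarrow> bool" where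
  "runs W P s T Q \<longleftrightarrow> (\<exists>t s'. exec W P s t s' \<and> t \<le> T \<and> Q s')"

lemma runs_Seq:
  assumes "runs W P s T Q" "\<And>s'. Q s' \<Longrightarrow> runs W P' s' T' Q'"
  shows "runs W (Seq P P') s (T + T') Q'"
  using assms unfolding runs_def by (metis add_mono exec.Seq)

text \<open>The invariant is indexed by the number of completed iterations. Each iteration pays one
  step for its test; the final failing test accounts for the \<open>+ 1\<close>.\<close>

lemma runs_While:
  assumes "I 0 s"
    and step: "\<And>i s. i < m \<Longrightarrow> I i s \<Longrightarrow> eval_test b s \<and> runs W P s T (I (Suc i))"
    and stop: "\<And>s. I m s \<Longrightarrow> \<not> eval_test b s"
  shows "runs W (While b P) s (m * Suc T + 1) (I m)"
proof -
  have "runs W (While b P) s (j * Suc T + 1) (I m)" if "I i s" "i + j = m" for i j s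
    using that
  proof (induction j arbitrary: i s)
    case 0
    then show ?case using stop[of s] unfolding runs_def
      by (intro exI[of _ 1] exI[of _ s]) (auto intro: exec_unit)
  next
    case (Suc j)
    then obtain t s' where 1: "exec W P s t s'" "t \<le> T" "I (Suc i) s'" and "eval_test b s"
      using step[of i s] unfolding runs_def by auto
    moreover obtain t' s'' where "exec W (While b P) s' t' s''" "t' \<le> j * Suc T + 1" "I m s''"
      using Suc.IH[of "Suc i" s'] 1 Suc.prems unfolding runs_def by auto
    ultimately show ?case unfolding runs_def
      by (intro exI[of _ "Suc (t + t')"] exI[of _ s'']) (auto intro: exec.WhileTrue)
  qed
  from this[of 0 s m] assms(1) show ?thesis by simp
qed

section \<open>Expressions and their evaluation in registers\<close>

datatype aexp = Num int | Var reg | Bin binop aexp aexp | Mem aexp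

fun aval :: "aexp \<Rightarrow> state \<Rightarrow> int" where
  "aval (Num v) s = v"
| "aval (Var r) s = regs s r"
| "aval (Bin f x y) s = eval_binop f (aval x s) (aval y s)"
| "aval (Mem x) s = mem s (nat (aval x s))"

text \<open>Every intermediate value must fit into a word, since an overflowing instruction has no
  \<open>exec\<close> rule.\<close>

fun asafe :: "int \<Rightarrow> aexp \<Rightarrow> state \<Rightarrow> bool" where
  "asafe W (Num v) s \<longleftrightarrow> \<bar>v\<bar> < W"
| "asafe W (Var r) s \<longleftrightarrow> \<bar>regs s r\<bar> < W"
| "asafe W (Bin f x y) s \<longleftrightarrow>
     asafe W x s \<and> asafe W y s \<and> \<bar>eval_binop f (aval x s) (aval y s)\<bar> < W"
| "asafe W (Mem x) s \<longleftrightarrow> asafe W x s \<and> 0 \<le> aval x s \<and> \<bar>mem s (nat (aval x s))\<bar> < W"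

fun avars :: "aexp \<Rightarrow> reg set" where
  "avars (Num v) = {}"
| "avars (Var r) = {r}"
| "avars (Bin f x y) = avars x \<union> avars y"
| "avars (Mem x) = avars x"

text \<open>\<open>or x x = x\<close>, so \<open>Op BitOr r a a\<close> copies register \<open>a\<close> to \<open>r\<close>.\<close>

fun acomp :: "aexp \<Rightarrow> reg \<Rightarrow> com" where
  "acomp (Num v) d = Const d v"
| "acomp (Var r) d = Op BitOr d r r"
| "acomp (Bin f x y) d = Seq (acomp x d) (Seq (acomp y (Suc d)) (Op f d d (Suc d)))"
| "acomp (Mem x) d = Seq (acomp x d) (Load d d)"

fun acost :: "aexp \<Rightarrow> nat" where
  "acost (Num v) = 1"
| "acost (Var r) = 1"
| "acost (Bin f x y) = acost x + (acost y + 1)"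
| "acost (Mem x) = acost x + 1"

lemma aval_agree: "avars e \<subseteq> {..<Z} \<Longrightarrow> agree Z s s' \<Longrightarrow> aval e s' = aval e s"
  by (induction e) (auto simp: agree_def)

lemma asafe_agree: "avars e \<subseteq> {..<Z} \<Longrightarrow> agree Z s s' \<Longrightarrow> asafe W e s' = asafe W e s"
  by (induction e) (auto simp: aval_agree, auto simp: agree_def)

lemma agree_trans: "agree Z s s' \<Longrightarrow> agree Z s' s'' \<Longrightarrow> agree Z s s''"
  by (auto simp: agree_def)

text \<open>The registers from \<open>d\<close> on act as an evaluation stack: the first operand
  rests in \<open>d\<close> while the second is computed in \<open>Suc d\<close> and above.\<close>

lemma exec_acomp:
  assumes "avars e \<subseteq> {..<d}" "asafe W e s"
  shows "\<exists>s'. exec W (acomp e d) s (acost e) s' \<and> regs s' d = aval e s \<and> agree d s s'"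
  using assms
proof (induction e arbitrary: d s)
  case (Num v)
  then show ?case
    by (intro exI[of _ "s\<lparr>regs := (regs s)(d := v)\<rparr>"]) (auto intro!: exec_unit simp: agree_def)
next
  case (Var r)
  then show ?case
    by (intro exI[of _ "s\<lparr>regs := (regs s)(d := regs s r)\<rparr>"])
      (auto intro!: exec_unit simp: agree_def)
next
  case (Bin f x y)
  then obtain s1 where 1: "exec W (acomp x d) s (acost x) s1" "regs s1 d = aval x s" "agree d s s1"
    by (metis Un_subset_iff asafe.simps(3) avars.simps(3))
  have y: "avars y \<subseteq> {..<d}" using Bin.prems by auto
  then have "avars y \<subseteq> {..<Suc d}" by auto
  moreover have "asafe W y s1" using asafe_agree[OF y 1(3)] Bin.prems by auto
  ultimately obtain s2 where 2: "exec W (acomp y (Suc d)) s1 (acost y) s2"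
      "regs s2 (Suc d) = aval y s1" "agree (Suc d) s1 s2"
    using Bin.IH(2)[of "Suc d" s1] by auto
  have "regs s2 (Suc d) = aval y s" using 2 aval_agree[OF y 1(3)] by auto
  moreover have "regs s2 d = aval x s" using 1 2 by (auto simp: agree_def)
  ultimately have "exec W (Op f d d (Suc d)) s2 1
      (s2\<lparr>regs := (regs s2)(d := eval_binop f (aval x s) (aval y s))\<rparr>)"
    using Bin.prems by (intro exec.Op) auto
  with 1 2 have "exec W (acomp (Bin f x y) d) s (acost (Bin f x y))
      (s2\<lparr>regs := (regs s2)(d := eval_binop f (aval x s) (aval y s))\<rparr>)"
    unfolding acomp.simps acost.simps by (blast intro: exec.Seq)
  then show ?case using 1 2 by (intro exI) (auto simp: agree_def)
next
  case (Mem x)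
  then obtain s1 where 1: "exec W (acomp x d) s (acost x) s1" "regs s1 d = aval x s" "agree d s s1"
    by (metis asafe.simps(4) avars.simps(4))
  have "exec W (Load d d) s1 1 (s1\<lparr>regs := (regs s1)(d := mem s (nat (aval x s)))\<rparr>)"
    using 1 Mem.prems by (intro exec.Load) (auto simp: agree_def)
  with 1(1) have "exec W (acomp (Mem x) d) s (acost (Mem x))
      (s1\<lparr>regs := (regs s1)(d := mem s (nat (aval x s)))\<rparr>)"
    unfolding acomp.simps acost.simps by (rule exec.Seq)
  with 1 show ?case by (intro exI) (auto simp: agree_def)
qed

section \<open>Loop-free statements of constant cost\<close>

datatype stm = Assign reg aexp | Write aexp aexp | Comp stm stm
  | IfLess aexp aexp stm stm | IfEq aexp aexp stm stm | Nop

fun sem :: "stm \<Rightarrow> state \<Rightarrow> state" where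
  "sem (Assign r e) s = s\<lparr>regs := (regs s)(r := aval e s)\<rparr>"
| "sem (Write a e) s = s\<lparr>mem := (mem s)(nat (aval a s) := aval e s)\<rparr>"
| "sem (Comp c d) s = sem d (sem c s)"
| "sem (IfLess a b c d) s = (if aval a s < aval b s then sem c s else sem d s)"
| "sem (IfEq a b c d) s = (if aval a s = aval b s then sem c s else sem d s)"
| "sem Nop s = s"

fun safe :: "int \<Rightarrow> stm \<Rightarrow> state \<Rightarrow> bool" where
  "safe W (Assign r e) s \<longleftrightarrow> asafe W e s"
| "safe W (Write a e) s \<longleftrightarrow> asafe W a s \<and> asafe W e s \<and> 0 \<le> aval a s"
| "safe W (Comp c d) s \<longleftrightarrow> safe W c s \<and> safe W d (sem c s)"
| "safe W (IfLess a b c d) s \<longleftrightarrow> asafe W a s \<and> asafe W b s \<and>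
     (if aval a s < aval b s then safe W c s else safe W d s)"
| "safe W (IfEq a b c d) s \<longleftrightarrow> asafe W a s \<and> asafe W b s \<and>
     (if aval a s = aval b s then safe W c s else safe W d s)"
| "safe W Nop s \<longleftrightarrow> True"

fun svars :: "stm \<Rightarrow> reg set" where
  "svars (Assign r e) = insert r (avars e)"
| "svars (Write a e) = avars a \<union> avars e"
| "svars (Comp c d) = svars c \<union> svars d"
| "svars (IfLess a b c d) = avars a \<union> avars b \<union> svars c \<union> svars d"
| "svars (IfEq a b c d) = avars a \<union> avars b \<union> svars c \<union> svars d"
| "svars Nop = {}"

fun compile :: "reg \<Rightarrow> stm \<Rightarrow> com" where
  "compile Z (Assign r e) = Seq (acomp e Z) (Op BitOr r Z Z)"
| "compile Z (Write a e) = Seq (acomp a Z) (Seq (acomp e (Suc Z)) (Store Z (Suc Z)))"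
| "compile Z (Comp c d) = Seq (compile Z c) (compile Z d)"
| "compile Z (IfLess a b c d) =
     Seq (acomp a Z) (Seq (acomp b (Suc Z)) (If (Less Z (Suc Z)) (compile Z c) (compile Z d)))"
| "compile Z (IfEq a b c d) =
     Seq (acomp a Z) (Seq (acomp b (Suc Z)) (If (Equal Z (Suc Z)) (compile Z c) (compile Z d)))"
| "compile Z Nop = Skip"

text \<open>Both branches of a conditional are charged, which makes the bound independent of the
  state. Loops enter only through \<open>runs_While\<close>.\<close>

fun cost :: "stm \<Rightarrow> nat" where
  "cost (Assign r e) = acost e + 1"
| "cost (Write a e) = acost a + (acost e + 1)"
| "cost (Comp c d) = cost c + cost d"
| "cost (IfLess a b c d) = acost a + (acost b + Suc (cost c + cost d))"
| "cost (IfEq a b c d) = acost a + (acost b + Suc (cost c + cost d))"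
| "cost Nop = 1"

lemma sem_agree:
  "svars c \<subseteq> {..<Z} \<Longrightarrow> agree Z s s' \<Longrightarrow> agree Z (sem c s) (sem c s')"
  by (induction c arbitrary: s s') (auto simp: aval_agree, auto simp: agree_def)

lemma safe_agree:
  "svars c \<subseteq> {..<Z} \<Longrightarrow> agree Z s s' \<Longrightarrow> safe W c s' = safe W c s"
proof (induction c arbitrary: s s')
  case (Comp c1 c2)
  then show ?case using sem_agree[of c1 Z s s'] by auto
qed (auto simp: aval_agree asafe_agree)

lemma exec_two_exprs:
  assumes "avars a \<subseteq> {..<Z}" "avars b \<subseteq> {..<Z}" "asafe W a s" "asafe W b s"
  shows "\<exists>s1 s2. exec W (acomp a Z) s (acost a) s1 \<and> exec W (acomp b (Suc Z)) s1 (acost b) s2 \<and>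
    regs s2 Z = aval a s \<and> regs s2 (Suc Z) = aval b s \<and> agree Z s s2"
proof -
  obtain s1 where 1: "exec W (acomp a Z) s (acost a) s1" "regs s1 Z = aval a s" "agree Z s s1"
    using exec_acomp assms by metis
  have "avars b \<subseteq> {..<Suc Z}" using assms(2) by auto
  moreover have "asafe W b s1" "aval b s1 = aval b s"
    using asafe_agree[OF assms(2) 1(3)] aval_agree[OF assms(2) 1(3)] assms by auto
  ultimately obtain s2 where "exec W (acomp b (Suc Z)) s1 (acost b) s2"
      "regs s2 (Suc Z) = aval b s" "agree (Suc Z) s1 s2"
    using exec_acomp by metis
  with 1 show ?thesis by (intro exI[of _ s1] exI[of _ s2]) (auto simp: agree_def)
qed

text \<open>Compiled code uses the registers from \<open>Z\<close> on as scratch, so the final state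
  is described only up to \<open>agree Z\<close>.\<close>

lemma runs_compile:
  assumes "svars c \<subseteq> {..<Z}" "safe W c s"
  shows "runs W (compile Z c) s (cost c) (agree Z (sem c s))"
  using assms
proof (induction c arbitrary: s)
  case (Assign r e)
  then obtain s1 where 1: "exec W (acomp e Z) s (acost e) s1" "regs s1 Z = aval e s" "agree Z s s1"
    using exec_acomp[of e Z W s] by auto
  have "\<bar>aval e s\<bar> < W" using Assign.prems by (cases e) auto
  then have "exec W (Op BitOr r Z Z) s1 1 (s1\<lparr>regs := (regs s1)(r := aval e s)\<rparr>)"
    using 1 by (intro exec.Op) auto
  with 1(1) have "exec W (compile Z (Assign r e)) s (cost (Assign r e))
      (s1\<lparr>regs := (regs s1)(r := aval e s)\<rparr>)"
    unfolding compile.simps cost.simps by (rule exec.Seq)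
  with 1 show ?case unfolding runs_def by (intro exI conjI) (auto simp: agree_def)
next
  case (Write a e)
  then obtain s1 s2 where 1: "exec W (acomp a Z) s (acost a) s1"
      "exec W (acomp e (Suc Z)) s1 (acost e) s2"
      "regs s2 Z = aval a s" "regs s2 (Suc Z) = aval e s" "agree Z s s2"
    using exec_two_exprs[of a Z e W s] by auto
  then have "exec W (Store Z (Suc Z)) s2 1 (s2\<lparr>mem := (mem s2)(nat (aval a s) := aval e s)\<rparr>)"
    using Write.prems exec.Store[of s2 Z W "Suc Z"] by auto
  with 1 have "exec W (compile Z (Write a e)) s (cost (Write a e))
      (s2\<lparr>mem := (mem s2)(nat (aval a s) := aval e s)\<rparr>)"
    unfolding compile.simps cost.simps by (blast intro: exec.Seq)
  with 1 show ?case unfolding runs_def by (intro exI conjI) (auto simp: agree_def)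
next
  case (Comp c d)
  \<comment> \<open>The first statement leaves a state that merely agrees with
    \<open>sem c s\<close> below \<open>Z\<close>; safety and effect of the second are insensitive
    to the difference.\<close>
  have "runs W (compile Z d) s' (cost d) (agree Z (sem d (sem c s)))" if "agree Z (sem c s) s'" for s'
  proof -
    have "runs W (compile Z d) s' (cost d) (agree Z (sem d s'))"
      using Comp that safe_agree[of d Z "sem c s" s' W] by auto
    moreover have "agree Z (sem d (sem c s)) (sem d s')"
      using sem_agree[of d Z] that Comp.prems by auto
    ultimately show ?thesis unfolding runs_def using agree_trans by blast
  qed
  with Comp show ?case by (auto intro: runs_Seq)
next
  case (IfLess a b c d)
  then obtain s1 s2 where 1: "exec W (acomp a Z) s (acost a) s1"
      "exec W (acomp b (Suc Z)) s1 (acost b) s2"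
      "regs s2 Z = aval a s" "regs s2 (Suc Z) = aval b s" "agree Z s s2"
    using exec_two_exprs[of a Z b W s] by auto
  have "runs W (compile Z x) s2 (cost x) (agree Z (sem x s))"
    if "x = (if aval a s < aval b s then c else d)" for x
  proof -
    have "svars x \<subseteq> {..<Z}" using that IfLess.prems by auto
    moreover have "runs W (compile Z x) s2 (cost x) (agree Z (sem x s2))"
      using that IfLess safe_agree[of c Z s s2 W] safe_agree[of d Z s s2 W] 1(5) by auto
    ultimately show ?thesis
      unfolding runs_def using agree_trans sem_agree[of x Z s s2] 1(5) by blast
  qed
  then obtain t s3 where 2: "exec W (if aval a s < aval b s then compile Z c else compile Z d) s2 t s3"
      "t \<le> cost c + cost d" "agree Z (sem (IfLess a b c d) s) s3"
    by (cases "aval a s < aval b s") (fastforce simp: runs_def)+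
  have "exec W (If (Less Z (Suc Z)) (compile Z c) (compile Z d)) s2 (Suc t) s3"
    using 1 2 by (cases "aval a s < aval b s") (auto intro: exec.IfTrue exec.IfFalse)
  then have "exec W (compile Z (IfLess a b c d)) s (acost a + (acost b + Suc t)) s3"
    unfolding compile.simps using 1 by (blast intro: exec.Seq)
  with 2 show ?case unfolding runs_def by (intro exI conjI) auto
next
  case (IfEq a b c d)
  then obtain s1 s2 where 1: "exec W (acomp a Z) s (acost a) s1"
      "exec W (acomp b (Suc Z)) s1 (acost b) s2"
      "regs s2 Z = aval a s" "regs s2 (Suc Z) = aval b s" "agree Z s s2"
    using exec_two_exprs[of a Z b W s] by auto
  have "runs W (compile Z x) s2 (cost x) (agree Z (sem x s))"
    if "x = (if aval a s = aval b s then c else d)" for x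
  proof -
    have "svars x \<subseteq> {..<Z}" using that IfEq.prems by auto
    moreover have "runs W (compile Z x) s2 (cost x) (agree Z (sem x s2))"
      using that IfEq safe_agree[of c Z s s2 W] safe_agree[of d Z s s2 W] 1(5) by auto
    ultimately show ?thesis
      unfolding runs_def using agree_trans sem_agree[of x Z s s2] 1(5) by blast
  qed
  then obtain t s3 where 2: "exec W (if aval a s = aval b s then compile Z c else compile Z d) s2 t s3"
      "t \<le> cost c + cost d" "agree Z (sem (IfEq a b c d) s) s3"
    by (cases "aval a s = aval b s") (fastforce simp: runs_def)+
  have "exec W (If (Equal Z (Suc Z)) (compile Z c) (compile Z d)) s2 (Suc t) s3"
    using 1 2 by (cases "aval a s = aval b s") (auto intro: exec.IfTrue exec.IfFalse)
  then have "exec W (compile Z (IfEq a b c d)) s (acost a + (acost b + Suc t)) s3"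
    unfolding compile.simps using 1 by (blast intro: exec.Seq)
  with 2 show ?case unfolding runs_def by (intro exI conjI) auto
next
  case Nop
  then show ?case unfolding runs_def by (auto intro!: exI exec_unit simp: agree_def)
qed

section \<open>The graph of a min-plus product\<close>

text \<open>Potential differences telescope along a walk. This provides the lower bound on
  distances.\<close>

lemma (in wf_digraph) potential_le_awalk_cost:
  fixes \<phi> :: "'a \<Rightarrow> real"
  assumes "\<And>e. e \<in> arcs G \<Longrightarrow> \<phi> (head G e) \<le> \<phi> (tail G e) + f e" "awalk u p v"
  shows "\<phi> v - \<phi> u \<le> awalk_cost f p"
  using assms(2)
proof (induction p arbitrary: u)
  case (Cons e p)
  then have "e \<in> arcs G" "tail G e = u" "awalk (head G e) p v" by (auto simp: awalk_Cons_iff)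
  with Cons.IH assms(1)[of e] show ?case by fastforce
qed (auto simp: awalk_Nil_iff)

text \<open>
  Vertices \<open>i < n\<close> stand for the rows of the first matrix, \<open>n + j\<close> for the columns of the second, and
  \<open>chain k p\<close> with \<open>p < S\<close> for the positions on the chain of the inner index \<open>k\<close>. The numbers
  \<open>\<alpha> i k\<close> and \<open>\<beta> k j\<close> are the matrix entries shifted by \<open>K\<close>. The remaining vertices below \<open>15 * n\<close>
  are isolated; they make the number of vertices an exact multiple of \<open>n\<close>.
\<close>

locale gadget =
  fixes n K D L :: nat and \<alpha> \<beta> :: "nat \<Rightarrow> nat \<Rightarrow> nat"
  assumes n: "0 < n" and K: "0 < K" "K \<le> n" and D: "0 < D" "D \<le> K"
    and L: "L = 2 * K div D"
    and size: "2 * n + K * Suc (2 * L) \<le> 15 * n"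
    and \<alpha>: "\<And>i k. i < n \<Longrightarrow> k < K \<Longrightarrow> \<alpha> i k \<le> 2 * K"
    and \<beta>: "\<And>k j. k < K \<Longrightarrow> j < n \<Longrightarrow> \<beta> k j \<le> 2 * K"
begin

abbreviation S :: nat where "S \<equiv> Suc (2 * L)"
abbreviation M :: nat where "M \<equiv> 6 * K"

definition chain :: "nat \<Rightarrow> nat \<Rightarrow> nat" where
  "chain k p = 2 * n + k * S + p"

text \<open>Oriented towards the larger vertex number: rows and columns precede all chain vertices.
  Position \<open>L\<close> is the midpoint of a chain, rows attach to its left and columns to its
  right. Consecutive chains are numbered consecutively, and \<open>0 < p\<close> keeps them from
  being joined.\<close>

definition link :: "nat \<Rightarrow> nat \<Rightarrow> nat option" where
  "link x y = (if y < 2 * n then None else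
     let k = (y - 2 * n) div S; p = (y - 2 * n) mod S in
     if K \<le> k then None
     else if x < n then (if p + \<alpha> x k div D = L then Some (M + \<alpha> x k mod D) else None)
     else if x < 2 * n then
       (if p = L + \<beta> k (x - n) div D then Some (M + \<beta> k (x - n) mod D) else None)
     else if x + 1 = y \<and> 0 < p then Some D else None)"

definition edge :: "nat \<Rightarrow> nat \<Rightarrow> nat option" where
  "edge u v = link (min u v) (max u v)"

definition graph :: "nat pair_pre_digraph" where
  "graph = \<lparr>pverts = {..<15 * n}, parcs = {(u, v). u < 15 * n \<and> v < 15 * n \<and> edge u v \<noteq> None}\<rparr>"

definition weight :: "nat \<times> nat \<Rightarrow> int" where
  "weight = (\<lambda>(u, v). int (the (edge u v)))"

lemma edge_commute: "edge u v = edge v u"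
  by (simp add: edge_def min.commute max.commute)

lemma chain_div_mod:
  assumes "p < S"
  shows "(chain k p - 2 * n) div S = k" "(chain k p - 2 * n) mod S = p"
proof -
  have "chain k p - 2 * n = p + k * S" by (simp add: chain_def)
  then show "(chain k p - 2 * n) div S = k" "(chain k p - 2 * n) mod S = p"
    using assms by (simp_all only: div_mult_self1 mod_mult_self1) simp_all
qed

lemma chain_less: "k < K \<Longrightarrow> p < S \<Longrightarrow> chain k p < 15 * n"
proof -
  assume "k < K" "p < S"
  then have "k * S + p < Suc k * S" by simp
  also have "\<dots> \<le> K * S" using \<open>k < K\<close> by (intro mult_le_mono1) simp
  finally show ?thesis using size by (simp add: chain_def)
qed

lemma \<alpha>_div: "i < n \<Longrightarrow> k < K \<Longrightarrow> \<alpha> i k div D \<le> L"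
  using \<alpha> div_le_mono L by simp

lemma \<beta>_div: "k < K \<Longrightarrow> j < n \<Longrightarrow> \<beta> k j div D \<le> L"
  using \<beta> div_le_mono L by simp

lemma edge_left:
  assumes "i < n" "k < K"
  shows "edge i (chain k (L - \<alpha> i k div D)) = Some (M + \<alpha> i k mod D)"
proof -
  have *: "L - \<alpha> i k div D < S" by simp
  have "i < chain k (L - \<alpha> i k div D)" "\<not> chain k (L - \<alpha> i k div D) < 2 * n"
    using assms by (auto simp: chain_def)
  then show ?thesis
    using assms \<alpha>_div[OF assms] by (simp add: edge_def link_def chain_div_mod[OF *])
qed

lemma edge_right:
  assumes "j < n" "k < K"
  shows "edge (n + j) (chain k (L + \<beta> k j div D)) = Some (M + \<beta> k j mod D)"
proof -
  have *: "L + \<beta> k j div D < S" using \<beta>_div[OF assms(2,1)] by simp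
  have "n + j < chain k (L + \<beta> k j div D)" "\<not> chain k (L + \<beta> k j div D) < 2 * n"
    using assms by (auto simp: chain_def)
  then show ?thesis
    using assms by (simp add: edge_def link_def chain_div_mod[OF *])
qed

lemma edge_chain:
  assumes "k < K" "Suc p < S"
  shows "edge (chain k p) (chain k (Suc p)) = Some D"
proof -
  have "chain k p + 1 = chain k (Suc p)" "\<not> chain k p < 2 * n" "\<not> chain k (Suc p) < 2 * n"
    by (auto simp: chain_def)
  moreover from this(1) have "min (chain k p) (chain k (Suc p)) = chain k p"
     "max (chain k p) (chain k (Suc p)) = chain k (Suc p)" by auto
  ultimately show ?thesis
    using assms(1) n by (simp add: edge_def link_def chain_div_mod[OF assms(2)])
qed

text \<open>Inversion into the three kinds of edges; absence of loops, range of weights and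
  feasibility of the potential are all case distinctions over it.\<close>

lemma link_cases:
  assumes "link x y = Some w"
  obtains (left) k where "x < n" "k < K" "y = chain k (L - \<alpha> x k div D)" "w = M + \<alpha> x k mod D"
  | (right) j k where "x = n + j" "j < n" "k < K" "y = chain k (L + \<beta> k j div D)"
      "w = M + \<beta> k j mod D"
  | (mid) k p where "k < K" "Suc p < S" "x = chain k p" "y = chain k (Suc p)" "w = D"
proof -
  define k p where "k = (y - 2 * n) div S" and "p = (y - 2 * n) mod S"
  have y: "2 * n \<le> y" and k: "k < K"
    using assms by (auto simp: link_def Let_def k_def[symmetric] split: if_splits)
  have yk: "y = chain k p"
  proof -
    have "y - 2 * n = k * S + p" unfolding k_def p_def by (rule div_mult_mod_eq[symmetric])
    then show ?thesis using y by (simp add: chain_def)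
  qed
  have p: "p < S" unfolding p_def by (rule mod_less_divisor) simp
  have *: "(if x < n then if p + \<alpha> x k div D = L then Some (M + \<alpha> x k mod D) else None
     else if x < 2 * n then
       (if p = L + \<beta> k (x - n) div D then Some (M + \<beta> k (x - n) mod D) else None)
     else if x + 1 = y \<and> 0 < p then Some D else None) = Some w"
    using assms y k by (simp add: link_def Let_def k_def[symmetric] p_def[symmetric])
  consider "x < n" | "n \<le> x" "x < 2 * n" | "2 * n \<le> x" by linarith
  then show thesis
  proof cases
    case 1
    then have "p = L - \<alpha> x k div D" "w = M + \<alpha> x k mod D" using * by (auto split: if_splits)
    then show thesis using left[of k] 1 k yk by simp
  next
    case 2
    then show thesis using * right[of "x - n" k] k yk by (auto split: if_splits)
  next
    case 3
    then have "x + 1 = y" "0 < p" "w = D" using * by (auto split: if_splits)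
    then show thesis using mid[of k "p - 1"] k yk p by (auto simp: chain_def)
  qed
qed

lemma edge_weight_range: "edge u v = Some w \<Longrightarrow> w \<in> insert D {M..<M + D}"
  unfolding edge_def using D by (elim link_cases) auto

section \<open>The graph as an instance of APSP\<close>

lemma pair_graph: "pair_graph graph"
proof
  show "finite (parcs graph)"
    by (rule finite_subset[of _ "{..<15 * n} \<times> {..<15 * n}"]) (auto simp: graph_def)
  show "symmetric (with_proj graph)"
    by (auto simp: symmetric_def graph_def edge_commute intro!: symI)
next
  fix e assume "e \<in> parcs graph"
  then show "fst e \<noteq> snd e" using n
    by (auto simp: graph_def edge_def elim!: link_cases) (auto simp: chain_def)
qed (auto simp: graph_def)

sublocale pair_graph graph by (rule pair_graph)

lemma weight_nonneg: "0 \<le> weight e"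
  by (cases e) (simp add: weight_def)

lemma graph_undirected: "(graph, weight) \<in> undirected_graphs (15 * n)"
proof -
  have "0 \<le> awalk_cost (\<lambda>e. real_of_int (weight e)) p" for p
    unfolding awalk_cost_def by (rule sum_list_nonneg) (auto simp: weight_nonneg)
  then have "no_negative_cycle graph weight" by (simp add: no_negative_cycle_def)
  moreover have "pair_digraph graph" ..
  ultimately show ?thesis using pair_graph
    by (auto simp: undirected_graphs_def directed_graphs_def graph_def weight_def edge_commute)
qed

text \<open>All chain edges share the weight \<open>D\<close>, and the outer edges show only the
  \<open>D\<close> residues offset by \<open>M\<close>.\<close>

lemma card_weights: "card (weight ` parcs graph) \<le> D + 1"
proof -
  have "weight ` parcs graph \<subseteq> int ` insert D {M..<M + D}"
    using edge_weight_range by (fastforce simp: graph_def weight_def)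
  then have "card (weight ` parcs graph) \<le> card (int ` insert D {M..<M + D})"
    by (intro card_mono) auto
  also have "\<dots> \<le> card (insert D {M..<M + D})" by (rule card_image_le) simp
  also have "\<dots> \<le> D + 1" by (simp add: card_insert_if)
  finally show ?thesis .
qed

text \<open>Weights stay below \<open>7 * K\<close>, so the exponent \<open>1\<close> suffices in
  the polynomial weight bound.\<close>

lemma weight_le: "e \<in> parcs graph \<Longrightarrow> \<bar>weight e\<bar> \<le> int (15 * n) ^ 1"
proof -
  assume "e \<in> parcs graph"
  then obtain u v w where "e = (u, v)" "edge u v = Some w" by (auto simp: graph_def)
  then show ?thesis using edge_weight_range[of u v w] D K by (auto simp: weight_def)
qed

section \<open>Distances from rows to columns\<close>

definition dist_chain :: "nat \<Rightarrow> nat \<Rightarrow> nat \<Rightarrow> int" where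
  "dist_chain i k p =
     int M + int (\<alpha> i k mod D) + int D * \<bar>int p - (int L - int (\<alpha> i k div D))\<bar>"

text \<open>An entry of the min-plus product shifted by \<open>2 * K\<close>, as both summands are
  shifted by \<open>K\<close>.\<close>

definition min_sum :: "nat \<Rightarrow> nat \<Rightarrow> nat" where
  "min_sum i j = Min ((\<lambda>k. \<alpha> i k + \<beta> k j) ` {..<K})"

text \<open>
  A lower bound for the distance from \<open>i\<close>. It is exact on the right-hand side, because a path
  that visits an outer vertex on its way pays at least two further edges of weight \<open>M\<close>.
\<close>

definition potential :: "nat \<Rightarrow> nat \<Rightarrow> int" where
  "potential i v = (if v = i then 0 else if v < n then 2 * int M
     else if v < 2 * n then 2 * int M + int (min_sum i (v - n))
     else dist_chain i ((v - 2 * n) div S) ((v - 2 * n) mod S))"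

lemma potential_chain:
  assumes "i < n" "p < S"
  shows "potential i (chain k p) = dist_chain i k p"
proof -
  have "\<not> chain k p < 2 * n" "chain k p \<noteq> i" "\<not> chain k p < n" using assms by (auto simp: chain_def)
  then show ?thesis unfolding potential_def chain_div_mod[OF assms(2)] by simp
qed

lemma dist_chain_ge: "int M \<le> dist_chain i k p"
  by (simp add: dist_chain_def)

text \<open>\<open>dist_chain i k p\<close> is the cost of entering chain \<open>k\<close> directly
  from row \<open>i\<close> and walking to position \<open>p\<close>. The walk costs at most
  \<open>2 * D * L \<le> 4 * K\<close> and the residue is below \<open>K\<close>, together less than
  \<open>M = 6 * K\<close>.\<close>

lemma dist_chain_le:
  assumes "i < n" "k < K" "p < S"
  shows "dist_chain i k p \<le> 2 * int M"
proof -
  have "\<bar>int p - (int L - int (\<alpha> i k div D))\<bar> \<le> 2 * int L"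
    using assms \<alpha>_div[OF assms(1,2)] by (simp add: abs_le_iff)
  then have "int D * \<bar>int p - (int L - int (\<alpha> i k div D))\<bar> \<le> int D * (2 * int L)"
    by (intro mult_left_mono) auto
  also have "\<dots> = int (2 * (D * L))" by simp
  also have "\<dots> \<le> int (2 * (2 * K))" unfolding L by (intro zle_int[THEN iffD2] mult_le_mono2) simp
  finally have "int D * \<bar>int p - (int L - int (\<alpha> i k div D))\<bar> \<le> 4 * int K" by simp
  moreover have "\<alpha> i k mod D < D" using D by simp
  ultimately show ?thesis unfolding dist_chain_def using D by linarith
qed

text \<open>Between the two attachment points lie
  \<open>\<alpha> i k div D + \<beta> k j div D\<close> edges of weight \<open>D\<close>; with the
  two residues they reassemble both entries by division with remainder.\<close>

lemma sum_via:
  assumes "i < n" "k < K" "j < n"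
  shows "dist_chain i k (L + \<beta> k j div D) + int (M + \<beta> k j mod D)
    = 2 * int M + int (\<alpha> i k + \<beta> k j)"
proof -
  have "int D * \<bar>int (L + \<beta> k j div D) - (int L - int (\<alpha> i k div D))\<bar>
      = int (D * (\<alpha> i k div D) + D * (\<beta> k j div D))"
    by (simp add: algebra_simps)
  moreover have "\<alpha> i k = D * (\<alpha> i k div D) + \<alpha> i k mod D" "\<beta> k j = D * (\<beta> k j div D) + \<beta> k j mod D"
    by simp_all
  ultimately show ?thesis unfolding dist_chain_def by linarith
qed

lemma min_sum_le: "k < K \<Longrightarrow> min_sum i j \<le> \<alpha> i k + \<beta> k j"
  unfolding min_sum_def by (intro Min_le) auto

text \<open>Feasibility is needed in both directions because an edge can be traversed both ways. At
  outer vertices it rests on the bounds \<open>M\<close> and \<open>2 * M\<close> for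
  \<open>dist_chain\<close>, along a chain on its slope \<open>D\<close>.\<close>

lemma potential_link:
  assumes "i < n" "link x y = Some w"
  shows "potential i y \<le> potential i x + int w" "potential i x \<le> potential i y + int w"
proof -
  from assms(2) have "potential i y \<le> potential i x + int w \<and> potential i x \<le> potential i y + int w"
  proof (cases rule: link_cases)
    case (left k)
    have "L - \<alpha> x k div D < S" by simp
    note p = potential_chain[OF assms(1) this, of k] dist_chain_le[OF assms(1) left(2) this]
    show ?thesis
    proof (cases "x = i")
      case True
      then have "dist_chain i k (L - \<alpha> x k div D) = int w"
        using left \<alpha>_div[of x k] by (simp add: dist_chain_def of_nat_diff)
      then show ?thesis using p True left by (simp add: potential_def)
    next
      case False
      \<comment> \<open>The value \<open>2 * M\<close> at another row is not too large: the chain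
        vertex has potential at least \<open>M\<close> and the edge weighs at least
        \<open>M\<close>.\<close>
      then have "potential i x = 2 * int M" using left by (simp add: potential_def)
      then show ?thesis using p left dist_chain_ge[of i k "L - \<alpha> x k div D"] by simp
    qed
  next
    case (right j k)
    have "L + \<beta> k j div D < S" using \<beta>_div[OF right(3,2)] by simp
    note p = potential_chain[OF assms(1) this, of k] dist_chain_le[OF assms(1) right(3) this]
    \<comment> \<open>Arriving at column \<open>j\<close> from chain \<open>k\<close> yields the sum
      for \<open>k\<close>, which is at least the minimum over all chains.\<close>
    have "potential i x = 2 * int M + int (min_sum i j)"
      using right assms(1) by (simp add: potential_def)
    then show ?thesis
      using p right sum_via[OF assms(1) right(3,2)] min_sum_le[OF right(3), of i j] by simp
  next
    case (mid k p)
    let ?z = "int L - int (\<alpha> i k div D)"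
    have "int D * \<bar>int (Suc p) - ?z\<bar> \<le> int D * (\<bar>int p - ?z\<bar> + 1)"
      "int D * \<bar>int p - ?z\<bar> \<le> int D * (\<bar>int (Suc p) - ?z\<bar> + 1)"
      by (intro mult_left_mono; simp)+
    then show ?thesis using mid potential_chain[OF assms(1), of p k]
        potential_chain[OF assms(1), of "Suc p" k]
      by (simp add: dist_chain_def algebra_simps)
  qed
  then show "potential i y \<le> potential i x + int w" "potential i x \<le> potential i y + int w" by auto
qed

lemma potential_edge:
  assumes "i < n" "edge u v = Some w"
  shows "potential i v \<le> potential i u + int w"
  using potential_link[OF assms(1), of "min u v" "max u v" w] assms(2)
  by (cases "u \<le> v") (auto simp: edge_def min_def max_def)

lemma awalk_edge:
  assumes "edge u v = Some w" "u < 15 * n" "v < 15 * n"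
  shows "awalk u [(u, v)] v" "awalk_cost (\<lambda>e. real_of_int (weight e)) [(u, v)] = real w"
proof -
  have "(u, v) \<in> parcs graph" using assms by (simp add: graph_def)
  then show "awalk u [(u, v)] v" using in_arcsD2[of u v] by (simp add: awalk_Cons_iff awalk_Nil_iff)
qed (use assms in \<open>simp add: weight_def\<close>)

lemma awalk_chain:
  assumes "k < K" "p + m < S"
  shows "\<exists>q. awalk (chain k p) q (chain k (p + m)) \<and>
    awalk_cost (\<lambda>e. real_of_int (weight e)) q = real (D * m)"
  using assms(2)
proof (induction m)
  case 0
  then have "chain k p \<in> pverts graph" using chain_less[OF assms(1), of p] by (simp add: graph_def)
  then show ?case by (intro exI[of _ "[]"]) (simp add: awalk_Nil_iff)
next
  case (Suc m)
  then obtain q where q: "awalk (chain k p) q (chain k (p + m))"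
    "awalk_cost (\<lambda>e. real_of_int (weight e)) q = real (D * m)" by auto
  have "Suc (p + m) < S" using Suc.prems by simp
  note e = awalk_edge[OF edge_chain[OF assms(1) this]]
  have "chain k (p + m) < 15 * n" "chain k (Suc (p + m)) < 15 * n"
    using chain_less[OF assms(1)] Suc.prems by auto
  note e = e[OF this]
  show ?case using q e(2) awalk_appendI[OF q(1) e(1)]
    by (intro exI[of _ "q @ [(chain k (p + m), chain k (Suc (p + m)))]"]) (auto simp: algebra_simps)
qed

lemma distance_graph:
  assumes "i < n" "j < n"
  shows "distance graph weight i (n + j) = ereal (real (2 * M + min_sum i j))"
proof (rule antisym)
  let ?f = "\<lambda>e. real_of_int (weight e)"
  \<comment> \<open>Upper bound: the route from the row along the chain of a minimizing
    \<open>k\<close> to the column.\<close>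
  have "min_sum i j \<in> (\<lambda>k. \<alpha> i k + \<beta> k j) ` {..<K}"
    unfolding min_sum_def using K by (intro Min_in) auto
  then obtain k where k: "k < K" "min_sum i j = \<alpha> i k + \<beta> k j" by auto
  let ?a = "\<alpha> i k div D" and ?b = "\<beta> k j div D"
  have ab: "?a \<le> L" "?b \<le> L" using \<alpha>_div \<beta>_div assms k by auto
  then have less: "L - ?a < S" "L + ?b < S" by auto
  obtain q where q: "awalk (chain k (L - ?a)) q (chain k (L + ?b))"
      "awalk_cost ?f q = real (D * (?a + ?b))"
    using awalk_chain[OF k(1), of "L - ?a" "?a + ?b"] ab by auto
  have e1: "awalk i [(i, chain k (L - ?a))] (chain k (L - ?a))"
    "awalk_cost ?f [(i, chain k (L - ?a))] = real (M + \<alpha> i k mod D)"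
    using awalk_edge[OF edge_left[OF assms(1) k(1)]] chain_less[OF k(1) less(1)] assms by auto
  have e2: "awalk (chain k (L + ?b)) [(chain k (L + ?b), n + j)] (n + j)"
    "awalk_cost ?f [(chain k (L + ?b), n + j)] = real (M + \<beta> k j mod D)"
    using awalk_edge[OF edge_right[OF assms(2) k(1), unfolded edge_commute[of "n + j"]]]
      chain_less[OF k(1) less(2)] assms by auto
  have "awalk i ([(i, chain k (L - ?a))] @ q @ [(chain k (L + ?b), n + j)]) (n + j)"
    using e1(1) q(1) e2(1) by (blast intro: awalk_appendI)
  then have "\<mu> ?f i (n + j) \<le> awalk_cost ?f ([(i, chain k (L - ?a))] @ q @ [(chain k (L + ?b), n + j)])"
    by (rule min_cost_le_walk_cost)
  also have "awalk_cost ?f ([(i, chain k (L - ?a))] @ q @ [(chain k (L + ?b), n + j)])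
      = real (M + \<alpha> i k mod D) + (real (D * (?a + ?b)) + real (M + \<beta> k j mod D))"
    using e1(2) q(2) e2(2) by (simp only: awalk_cost_append)
  also have "\<dots> = real (2 * M + ((D * ?a + \<alpha> i k mod D) + (D * ?b + \<beta> k j mod D)))"
  proof -
    have "M + x + (D * (y + z) + (M + w)) = 2 * M + ((D * y + x) + (D * z + w))" for x y z w
      by (simp add: algebra_simps)
    then show ?thesis by (simp only: of_nat_add[symmetric])
  qed
  also have "\<dots> = real (2 * M + min_sum i j)" unfolding mult_div_mod_eq k(2) ..
  finally show "\<mu> ?f i (n + j) \<le> ereal (real (2 * M + min_sum i j))" .

  \<comment> \<open>Lower bound: the potential is \<open>0\<close> at \<open>i\<close> and equals
    the claimed distance at \<open>n + j\<close>.\<close>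
  have "real (2 * M + min_sum i j) \<le> awalk_cost ?f p" if "awalk i p (n + j)" for p
  proof -
    have "real_of_int (potential i (n + j)) - real_of_int (potential i i) \<le> awalk_cost ?f p"
    proof (rule potential_le_awalk_cost[OF _ that])
      fix e assume "e \<in> parcs graph"
      then obtain u v w where "e = (u, v)" "edge u v = Some w" by (auto simp: graph_def)
      with potential_edge[OF assms(1), of u v w]
      show "real_of_int (potential i (snd e)) \<le> real_of_int (potential i (fst e)) + real_of_int (weight e)"
        by (simp add: weight_def)
    qed
    then show ?thesis using assms by (simp add: potential_def)
  qed
  then show "ereal (real (2 * M + min_sum i j)) \<le> \<mu> ?f i (n + j)"
    unfolding \<mu>_def by (intro INF_greatest) auto
qed

end

section \<open>The reduction program\<close>

abbreviation Plus :: "aexp \<Rightarrow> aexp \<Rightarrow> aexp" (infixl "\<^bold>+" 65) where "x \<^bold>+ y \<equiv> Bin Add x y"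
abbreviation Minus :: "aexp \<Rightarrow> aexp \<Rightarrow> aexp" (infixl "\<^bold>-" 65) where "x \<^bold>- y \<equiv> Bin Sub x y"
abbreviation Times :: "aexp \<Rightarrow> aexp \<Rightarrow> aexp" (infixl "\<^bold>*" 70) where "x \<^bold>* y \<equiv> Bin Mul x y"
abbreviation Quot :: "aexp \<Rightarrow> aexp \<Rightarrow> aexp" (infixl "\<^bold>'/" 70) where "x \<^bold>/ y \<equiv> Bin Div x y"
abbreviation Rem :: "aexp \<Rightarrow> aexp \<Rightarrow> aexp" (infixl "\<^bold>%" 70) where "x \<^bold>% y \<equiv> Bin Mod x y"
abbreviation Then :: "stm \<Rightarrow> stm \<Rightarrow> stm" (infixr "\<^bold>;" 60) where "c \<^bold>; d \<equiv> Comp c d"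

text \<open>\<open>R\<close> bounds the registers of the APSP algorithm. The variables of the
  reduction lie above them, and \<open>rZ\<close> is the first scratch register of the compiled
  code.\<close>

context
  fixes R :: nat
begin

abbreviation (input) "rn \<equiv> R + 3"
abbreviation (input) "rK \<equiv> R + 4"
abbreviation (input) "rD \<equiv> R + 5"
abbreviation (input) "rL \<equiv> R + 6"
abbreviation (input) "rN \<equiv> R + 7"
abbreviation (input) "rF \<equiv> R + 8"
abbreviation (input) "rE \<equiv> R + 9"
abbreviation (input) "re \<equiv> R + 10"
abbreviation (input) "rx \<equiv> R + 11"
abbreviation (input) "ry \<equiv> R + 12"
abbreviation (input) "rk \<equiv> R + 13"
abbreviation (input) "rp \<equiv> R + 14"
abbreviation (input) "rz \<equiv> R + 15"
abbreviation (input) "rb \<equiv> R + 16"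
abbreviation (input) "rw \<equiv> R + 17"
abbreviation (input) "rt \<equiv> R + 18"
abbreviation (input) "rq \<equiv> R + 19"
abbreviation (input) "rS \<equiv> R + 20"
abbreviation (input) "rnn \<equiv> R + 21"
abbreviation (input) "rZ \<equiv> R + 22"

text \<open>The subtracted \<open>1\<close> leaves room for the chain weight \<open>D\<close> next
  to the \<open>D\<close> outer weights. The conditional takes the maximum with
  \<open>1\<close>.\<close>

definition dims_stm :: stm where
  "dims_stm =
     Assign rn (Mem (Num 0)) \<^bold>;
     Assign rK (Mem (Num 1)) \<^bold>;
     Assign rD (Var rK \<^bold>* Var rK \<^bold>/ Var rn \<^bold>- Num 1) \<^bold>;
     IfLess (Var rD) (Num 1) (Assign rD (Num 1)) Nop"

text \<open>\<open>rE\<close> is the number of vertex pairs, and \<open>rF\<close> the first cell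
  behind an APSP input: one header word and two words per pair.\<close>

definition derived_stm :: stm where
  "derived_stm =
     Assign rL (Num 2 \<^bold>* Var rK \<^bold>/ Var rD) \<^bold>;
     Assign rS (Num 2 \<^bold>* Var rL \<^bold>+ Num 1) \<^bold>;
     Assign rnn (Num 2 \<^bold>* Var rn) \<^bold>;
     Assign rN (Num 15 \<^bold>* Var rn) \<^bold>;
     Assign rE (Var rN \<^bold>* Var rN) \<^bold>;
     Assign rF (Num 2 \<^bold>* Var rE \<^bold>+ Num 1) \<^bold>;
     Assign re (Num 0)"

definition setup_stm :: stm where
  "setup_stm = dims_stm \<^bold>; derived_stm"

text \<open>The loop counter encodes a pair of vertices in row-major order. The pair is sorted
  because \<open>link\<close> expects the smaller vertex first.\<close>

definition decode_stm :: stm where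
  "decode_stm =
     Assign rx (Var re \<^bold>/ Var rN) \<^bold>;
     Assign ry (Var re \<^bold>% Var rN) \<^bold>;
     IfLess (Var ry) (Var rx) (Assign rt (Var rx) \<^bold>; Assign rx (Var ry) \<^bold>; Assign ry (Var rt)) Nop \<^bold>;
     Assign rb (Num 0) \<^bold>;
     Assign rw (Num 0)"

text \<open>The branches follow \<open>link\<close>; \<open>rb\<close> and \<open>rw\<close> are
  preset to the encoding of a missing arc. The offsets \<open>3\<close> and \<open>3 + n * K\<close>
  skip the dimensions and the first matrix, and adding \<open>rK\<close> shifts an entry to \<alpha>
  or \<beta>.\<close>

definition link_stm :: stm where
  "link_stm =
     IfLess (Var ry) (Var rnn) Nop (
       Assign rq (Var ry \<^bold>- Var rnn) \<^bold>;
       Assign rk (Var rq \<^bold>/ Var rS) \<^bold>;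
       Assign rp (Var rq \<^bold>% Var rS) \<^bold>;
       IfLess (Var rk) (Var rK) (
         IfLess (Var rx) (Var rn) (
           Assign rz (Mem (Num 3 \<^bold>+ Var rx \<^bold>* Var rK \<^bold>+ Var rk) \<^bold>+ Var rK) \<^bold>;
           IfEq (Var rp \<^bold>+ Var rz \<^bold>/ Var rD) (Var rL)
             (Assign rb (Num 1) \<^bold>; Assign rw (Num 6 \<^bold>* Var rK \<^bold>+ Var rz \<^bold>% Var rD)) Nop)
         (IfLess (Var rx) (Var rnn) (
           Assign rz (Mem (Num 3 \<^bold>+ Var rn \<^bold>* Var rK \<^bold>+ Var rk \<^bold>* Var rn \<^bold>+ (Var rx \<^bold>- Var rn))
             \<^bold>+ Var rK) \<^bold>;
           IfEq (Var rp) (Var rL \<^bold>+ Var rz \<^bold>/ Var rD)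
             (Assign rb (Num 1) \<^bold>; Assign rw (Num 6 \<^bold>* Var rK \<^bold>+ Var rz \<^bold>% Var rD)) Nop)
         (IfEq (Var rx \<^bold>+ Num 1) (Var ry)
           (IfLess (Num 0) (Var rp) (Assign rb (Num 1) \<^bold>; Assign rw (Var rD)) Nop) Nop)))
       Nop)"

definition write_stm :: stm where
  "write_stm =
     Write (Var rF \<^bold>+ Num 2 \<^bold>* Var re) (Var rb) \<^bold>;
     Write (Var rF \<^bold>+ Num 2 \<^bold>* Var re \<^bold>+ Num 1) (Var rw) \<^bold>;
     Assign re (Var re \<^bold>+ Num 1)"

text \<open>
  The adjacency matrix overlaps the input, so it is first built behind its final position and
  moved only when the input is no longer needed. The move also clears the memory behind it.
\<close>

definition build_stm :: stm where
  "build_stm = decode_stm \<^bold>; link_stm \<^bold>; write_stm"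

definition init_move_stm :: stm where
  "init_move_stm = Assign rt (Num 2 \<^bold>* Var rE) \<^bold>; Assign re (Num 0)"

definition move_stm :: stm where
  "move_stm =
     Write (Var re \<^bold>+ Num 1) (Mem (Var rF \<^bold>+ Var re)) \<^bold>;
     Write (Var rF \<^bold>+ Var re) (Num 0) \<^bold>;
     Assign re (Var re \<^bold>+ Num 1)"

definition header_stm :: stm where
  "header_stm = Write (Num 0) (Var rN)"

definition init_read_stm :: stm where
  "init_read_stm = Assign rt (Var rn \<^bold>* Var rn) \<^bold>; Assign re (Num 0)"

text \<open>
  The cell read in iteration \<open>e\<close> has an address greater than \<open>e\<close>, so the output may overwrite
  the distance matrix from below. The subtracted \<open>14 * K\<close> is \<open>2 * M + 2 * K\<close>.
\<close>

definition read_stm :: stm where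
  "read_stm =
     Assign rx (Var re \<^bold>/ Var rn) \<^bold>;
     Assign ry (Var re \<^bold>% Var rn) \<^bold>;
     Write (Var re)
       (Mem (Num 2 \<^bold>* (Var rx \<^bold>* Var rN \<^bold>+ (Var rn \<^bold>+ Var ry)) \<^bold>+ Num 1) \<^bold>- Num 14 \<^bold>* Var rK) \<^bold>;
     Assign re (Var re \<^bold>+ Num 1)"

definition encode_com :: com where
  "encode_com =
     Seq (compile rZ setup_stm)
     (Seq (While (Less re rE) (compile rZ build_stm))
     (Seq (compile rZ init_move_stm)
     (Seq (While (Less re rt) (compile rZ move_stm))
       (compile rZ header_stm))))"

definition decode_com :: com where
  "decode_com = Seq (compile rZ init_read_stm) (While (Less re rt) (compile rZ read_stm))"

end

section \<open>Correctness and running time of the reduction program\<close>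

lemma svars_stm:
  "svars (setup_stm R) \<subseteq> {..<R + 22}" "svars (build_stm R) \<subseteq> {..<R + 22}"
  "svars (init_move_stm R) \<subseteq> {..<R + 22}" "svars (move_stm R) \<subseteq> {..<R + 22}"
  "svars (header_stm R) \<subseteq> {..<R + 22}" "svars (init_read_stm R) \<subseteq> {..<R + 22}"
  "svars (read_stm R) \<subseteq> {..<R + 22}"
  by (auto simp: setup_stm_def dims_stm_def derived_stm_def build_stm_def decode_stm_def link_stm_def write_stm_def
      init_move_stm_def move_stm_def header_stm_def init_read_stm_def read_stm_def)

lemma runs_compile_post:
  assumes "svars c \<subseteq> {..<Z}" "safe W c s" "\<And>s'. agree Z (sem c s) s' \<Longrightarrow> Q s'"
  shows "runs W (compile Z c) s (cost c) Q"
  using runs_compile[OF assms(1,2)] assms(3) unfolding runs_def by blast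

lemma runs_compile_inv:
  assumes "svars c \<subseteq> {..<Z}" "\<And>s s'. agree Z s s' \<Longrightarrow> Q s \<Longrightarrow> Q s'"
    and "safe W c s \<and> Q (sem c s)"
  shows "runs W (compile Z c) s (cost c) Q"
  using assms runs_compile_post[of c Z W s Q] by blast

text \<open>An adjacency matrix on \<open>15 * n\<close> vertices takes
  \<open>2 * (15 * n)\<^sup>2 = 450 * n * n\<close> words, so two copies reach up to address
  \<open>900 * n * n\<close>, which \<open>W\<close> exceeds. By \<open>input_end\<close> the memory
  behind the two copies is zero, as in the initial state of the APSP algorithm.\<close>

locale reduction = gadget +
  fixes R :: nat and W :: int and input :: "nat \<Rightarrow> int"
  assumes D_eq: "D = max 1 (K * K div n - 1)"
    and W: "1000 * (int n * int n) + 1000 < W"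
    and input_dims: "input 0 = int n" "input 1 = int K"
    and input_A: "\<And>i k. i < n \<Longrightarrow> k < K \<Longrightarrow> input (3 + i * K + k) + int K = int (\<alpha> i k)"
    and input_B: "\<And>k j. k < K \<Longrightarrow> j < n \<Longrightarrow> input (3 + n * K + k * n + j) + int K = int (\<beta> k j)"
    and input_end: "\<And>a. 450 * (n * n) < a \<Longrightarrow> input a = 0"
begin

text \<open>The registers below \<open>R\<close> are kept at zero because the APSP algorithm starts
  from them.\<close>

definition params :: "state \<Rightarrow> bool" where
  "params s \<longleftrightarrow> regs s (rn R) = int n \<and> regs s (rK R) = int K \<and> regs s (rD R) = int D \<and>
     regs s (rL R) = int L \<and> regs s (rN R) = 15 * int n \<and>
     regs s (rF R) = 450 * (int n * int n) + 1 \<and> regs s (rE R) = 225 * (int n * int n) \<and>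
     regs s (rS R) = int S \<and> regs s (rnn R) = 2 * int n \<and> (\<forall>r<R. regs s r = 0)"

lemma params_agree: "agree (R + 22) s s' \<Longrightarrow> params s \<Longrightarrow> params s'"
  by (simp add: params_def agree_def)

text \<open>\<open>linarith\<close> treats products of variables as atoms; these comparisons between
  products make the overflow conditions linear.\<close>

lemma bounds:
  "int n \<le> int n * int n" "0 < int n" "int K \<le> int n" "0 < int K" "int D \<le> int K" "0 < int D"
  "int L \<le> 2 * int K" "int K * int K \<le> int n * int n" "int n * int K \<le> int n * int n"
proof -
  show "int n \<le> int n * int n" using n by (simp add: mult_le_cancel_left1)
  show "0 < int n" "int K \<le> int n" "0 < int K" "int D \<le> int K" "0 < int D" using n K D by auto
  have "L \<le> 2 * K" unfolding L by (rule div_le_dividend)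
  then show "int L \<le> 2 * int K" by linarith
  show "int K * int K \<le> int n * int n" "int n * int K \<le> int n * int n"
    using K by (auto intro!: mult_mono)
qed

lemma dims_correct:
  assumes "\<forall>r. regs s r = 0" "mem s = input"
  defines "s' \<equiv> sem (dims_stm R) s"
  shows "safe W (dims_stm R) s \<and> regs s' (rn R) = int n \<and> regs s' (rK R) = int K \<and>
    regs s' (rD R) = int D \<and> (\<forall>r<R. regs s' r = 0) \<and> mem s' = input"
proof -
  define d where "d = int K * int K div int n"
  note b = bounds W
  have d: "0 \<le> d" "d \<le> int n * int n"
  proof -
    show "0 \<le> d" by (simp add: d_def pos_imp_zdiv_nonneg_iff n)
    have "d \<le> int K * int K"
      using div_le_dividend[of "K * K" n] by (simp add: d_def flip: of_nat_mult of_nat_div)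
    then show "d \<le> int n * int n" using bounds(8) by linarith
  qed
  have D1: "int D = (if d - 1 < 1 then 1 else d - 1)"
  proof -
    have "d = int (K * K div n)" by (simp add: d_def of_nat_div)
    then show ?thesis unfolding D_eq by (auto simp: max_def of_nat_diff)
  qed
  have dW: "\<bar>d - 1\<bar> < W" "\<bar>d\<bar> < W" using b d by linarith+
  have W': "int n < W" "int K < W" "1 < W" "\<bar>int K * int K\<bar> < W" "0 < W"
    using b zero_le_square[of "int K"] by linarith+
  show ?thesis using assms(1,2) D1 dW W'
    by (cases "d - 1 < 1") (simp_all add: s'_def dims_stm_def input_dims input_dims(2)[simplified] flip: d_def)
qed

lemma derived_correct:
  assumes "regs s (rn R) = int n \<and> regs s (rK R) = int K \<and> regs s (rD R) = int D \<and>
    (\<forall>r<R. regs s r = 0) \<and> mem s = input"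
  defines "s' \<equiv> sem (derived_stm R) s"
  shows "safe W (derived_stm R) s \<and> params s' \<and> regs s' (re R) = 0 \<and> mem s' = input"
proof -
  note b = bounds W
  have L1: "2 * int K div int D = int L" unfolding L by (simp add: of_nat_div)
  show ?thesis using assms(1)
    by (simp add: s'_def derived_stm_def params_def L1; intro conjI; use b in linarith)
qed

lemma decode_correct:
  assumes "params s" "regs s (re R) = int e" "e < 225 * (n * n)"
  defines "u \<equiv> e div (15 * n)" and "v \<equiv> e mod (15 * n)"
  defines "s' \<equiv> sem (decode_stm R) s"
  shows "safe W (decode_stm R) s" "params s'" "regs s' (re R) = int e"
    "regs s' (rx R) = int (min u v)" "regs s' (ry R) = int (max u v)"
    "regs s' (rb R) = 0" "regs s' (rw R) = 0" "mem s' = mem s"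
proof -
  note b = bounds W
  have e: "int e < 225 * (int n * int n)" using assms(3) by (simp flip: of_nat_mult)
  have uv: "int e div (15 * int n) = int u" "int e mod (15 * int n) = int v"
    by (simp_all add: u_def v_def of_nat_div of_nat_mod)
  have v: "int v < 15 * int n" using mod_less_divisor[of "15 * n" e] n unfolding v_def by linarith
  have "u \<le> e" unfolding u_def by (rule div_le_dividend)
  then have u: "int u < 225 * (int n * int n)" using e by linarith
  show "safe W (decode_stm R) s" "params s'" "regs s' (re R) = int e"
    "regs s' (rx R) = int (min u v)" "regs s' (ry R) = int (max u v)"
    "regs s' (rb R) = 0" "regs s' (rw R) = 0" "mem s' = mem s"
    unfolding s'_def using assms(1,2)
    by (cases "v < u"; simp add: decode_stm_def params_def uv;
        (intro conjI)?; (use b e u v in linarith)?)+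
qed

lemma link_correct:
  assumes "params s" "regs s (rx R) = int x" "regs s (ry R) = int y" "x < 15 * n" "y < 15 * n"
    and "regs s (rb R) = 0" "regs s (rw R) = 0"
    and "\<And>a. a < 450 * (n * n) + 1 \<Longrightarrow> mem s a = input a"
  defines "s' \<equiv> sem (link_stm R) s"
  shows "safe W (link_stm R) s" "params s'" "regs s' (re R) = regs s (re R)"
    "regs s' (rb R) = (case link x y of None \<Rightarrow> 0 | Some _ \<Rightarrow> 1)"
    "regs s' (rw R) = (case link x y of None \<Rightarrow> 0 | Some w \<Rightarrow> int w)"
    "mem s' = mem s"
proof -
  define k p where "k = (y - 2 * n) div S" and "p = (y - 2 * n) mod S"
  note b = bounds W
  have xy: "int x < 15 * int n" "int y < 15 * int n" using assms(4,5) by auto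
  have "k \<le> y" unfolding k_def by (metis diff_le_self div_le_dividend order_trans)
  moreover have "p \<le> y" unfolding p_def by (metis diff_le_self mod_less_eq_dividend order_trans)
  ultimately have kp: "int k < 15 * int n" "int p < 15 * int n" using xy by linarith+
  have kpe: "(int y - 2 * int n) div (1 + 2 * int L) = int k"
      "(int y - 2 * int n) mod (1 + 2 * int L) = int p" if "2 * n \<le> y"
    using that by (simp_all add: k_def p_def of_nat_div of_nat_mod of_nat_diff algebra_simps)
  have link: "link x y = (if y < 2 * n then None else if K \<le> k then None
     else if x < n then (if p + \<alpha> x k div D = L then Some (M + \<alpha> x k mod D) else None)
     else if x < 2 * n then
       (if p = L + \<beta> k (x - n) div D then Some (M + \<beta> k (x - n) mod D) else None)
     else if x + 1 = y \<and> 0 < p then Some D else None)"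
    unfolding link_def k_def p_def Let_def ..
  have z: "int z < W \<and> int (z div D) \<le> 2 * int n \<and> int (z mod D) \<le> int n" if "z \<le> 2 * K" for z
  proof -
    have "z div D \<le> z" "z mod D \<le> z" "z mod D < D" using D by auto
    then show ?thesis using that b by linarith
  qed
  consider "y < 2 * n" | "2 * n \<le> y" "K \<le> k" | "2 * n \<le> y" "k < K" "x < n"
    | "2 * n \<le> y" "k < K" "n \<le> x" "x < 2 * n" | "2 * n \<le> y" "k < K" "2 * n \<le> x"
    by linarith
  then have "safe W (link_stm R) s \<and> params s' \<and> regs s' (re R) = regs s (re R) \<and>
    regs s' (rb R) = (case link x y of None \<Rightarrow> 0 | Some _ \<Rightarrow> 1) \<and>
    regs s' (rw R) = (case link x y of None \<Rightarrow> 0 | Some w \<Rightarrow> int w) \<and>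
    mem s' = mem s"
  proof cases
    case 1
    then show ?thesis using assms(1-3,6,7)
      by (simp add: s'_def link link_stm_def params_def; intro conjI; use b xy in linarith)
  next
    case 2
    then show ?thesis using assms(1-3,6,7)
      by (simp add: s'_def link link_stm_def params_def kpe; intro conjI; use b xy kp in linarith)
  next
    case 3
    let ?z = "\<alpha> x k"
    \<comment> \<open>The address lies among the first \<open>450 * (n * n) + 1\<close> cells, where
      the memory still holds the input.\<close>
    have "x * K + k < n * K"
      using mult_le_mono1[of "Suc x" n K] 3 by simp
    also have "\<dots> \<le> n * n" using K by simp
    finally have xk: "x * K + k < n * n" .
    then have xk': "int x * int K + int k < int n * int n"
      by (simp flip: of_nat_mult of_nat_add)
    have a: "nat (3 + int x * int K + int k) = 3 + x * K + k" by (simp add: nat_add_distrib nat_mult_distrib)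
    have m: "mem s (3 + x * K + k) = int ?z - int K"
      using input_A[of x k] 3 xk assms(8)[of "3 + x * K + k"] n by simp
    have zz: "int ?z < W" "int (?z div D) \<le> 2 * int n" "int (?z mod D) \<le> int n"
      using z[OF \<alpha>[of x k]] 3 by auto
    have c: "int p + int (?z div D) = int L \<longleftrightarrow> p + ?z div D = L" by linarith
    have zd: "int ?z div int D = int (?z div D)" "int ?z mod int D = int (?z mod D)"
      by (simp_all add: of_nat_div of_nat_mod)
    have xK: "0 \<le> int x * int K" "int k \<ge> 0" by simp_all
    show ?thesis using 3 assms(1-3,6,7)
      by (cases "p + ?z div D = L"; simp add: s'_def link link_stm_def params_def kpe a m zd c;
          intro conjI; use b xy kp xk' zz xK in linarith)
  next
    case 4
    define j where "j = x - n"
    let ?z = "\<beta> k j"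
    have j: "j < n" "x = n + j" using 4 by (auto simp: j_def)
    have "k * n + j < K * n" using mult_le_mono1[of "Suc k" K n] 4 j by simp
    also have "\<dots> \<le> n * n" using K by simp
    finally have xk: "k * n + j < n * n" .
    then have xk': "int k * int n + int j < int n * int n"
      by (simp flip: of_nat_mult of_nat_add)
    have a: "nat (3 + int n * int K + int k * int n + int j) = 3 + n * K + k * n + j"
      by (simp add: nat_add_distrib nat_mult_distrib)
    have "n * K \<le> n * n" "0 < n * n" using K n by simp_all
    with xk have "3 + n * K + k * n + j < 450 * (n * n) + 1" by linarith
    then have m: "mem s (3 + n * K + k * n + j) = int ?z - int K"
      using input_B[of k j] 4 j assms(8)[of "3 + n * K + k * n + j"] by simp
    have zz: "int ?z < W" "int (?z div D) \<le> 2 * int n" "int (?z mod D) \<le> int n"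
      using z[OF \<beta>[of k j]] 4 j by auto
    have c: "int p = int L + int (?z div D) \<longleftrightarrow> p = L + ?z div D" by linarith
    have zd: "int ?z div int D = int (?z div D)" "int ?z mod int D = int (?z mod D)"
      by (simp_all add: of_nat_div of_nat_mod)
    have xK: "0 \<le> int n * int K" "0 \<le> int k * int n" by simp_all
    show ?thesis using 4 j(1) assms(1-3,6,7) unfolding link
      by (cases "p = L + ?z div D"; simp add: s'_def j(2) link_stm_def params_def kpe a m zd c;
          intro conjI; use b xy kp xk' zz xK j in linarith)
  next
    case 5
    show ?thesis using 5 assms(1-3,6,7)
      by (simp add: s'_def link link_stm_def params_def kpe; intro conjI; use b xy kp in linarith)
  qed
  then show "safe W (link_stm R) s" "params s'" "regs s' (re R) = regs s (re R)"
    "regs s' (rb R) = (case link x y of None \<Rightarrow> 0 | Some _ \<Rightarrow> 1)"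
    "regs s' (rw R) = (case link x y of None \<Rightarrow> 0 | Some w \<Rightarrow> int w)"
    "mem s' = mem s" by blast+
qed

text \<open>Word \<open>c\<close> of the adjacency matrix behind the header: it belongs to pair
  \<open>c div 2\<close>, even words are presence flags and odd words weights.\<close>

definition cell :: "nat \<Rightarrow> int" where
  "cell c = (case edge (c div 2 div (15 * n)) (c div 2 mod (15 * n)) of
     None \<Rightarrow> 0 | Some w \<Rightarrow> if even c then 1 else int w)"

lemma cell_less: "\<bar>cell c\<bar> < W"
proof (cases "edge (c div 2 div (15 * n)) (c div 2 mod (15 * n))")
  case (Some w)
  then have "int w \<le> 7 * int n" using edge_weight_range[OF Some] D K by auto
  moreover have "7 * int n < W" "1 < W" using bounds W by linarith+
  ultimately show ?thesis using Some by (simp add: cell_def)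
next
  case None
  moreover have "0 < W" using bounds W by linarith
  ultimately show ?thesis by (simp add: cell_def)
qed

text \<open>The cells up to \<open>450 * (n * n)\<close> retain the input, which later iterations
  still read.\<close>

definition build_inv :: "nat \<Rightarrow> state \<Rightarrow> bool" where
  "build_inv i s \<longleftrightarrow> params s \<and> regs s (re R) = int i \<and>
     (\<forall>a. mem s a = (if 450 * (n * n) < a \<and> a \<le> 450 * (n * n) + 2 * i
        then cell (a - (450 * (n * n) + 1)) else input a))"

lemma build_step:
  assumes "i < 225 * (n * n)" "build_inv i s"
  shows "safe W (build_stm R) s \<and> build_inv (Suc i) (sem (build_stm R) s)"
proof -
  note b = bounds W
  define u v where "u = i div (15 * n)" and "v = i mod (15 * n)"
  define s1 where "s1 = sem (decode_stm R) s"
  define s2 where "s2 = sem (link_stm R) s1"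
  have s: "params s" "regs s (re R) = int i" using assms(2) by (auto simp: build_inv_def)
  note d = decode_correct[OF s assms(1), folded s1_def u_def v_def]
  have v: "v < 15 * n" using n by (simp add: v_def)
  have u: "u < 15 * n" unfolding u_def using assms(1) by (simp add: less_mult_imp_div_less mult.commute)
  have "mem s1 a = input a" if "a < 450 * (n * n) + 1" for a
    using d(8) assms(2) that by (simp add: build_inv_def)
  then have l: "safe W (link_stm R) s1" "params s2" "regs s2 (re R) = int i"
    "regs s2 (rb R) = (case edge u v of None \<Rightarrow> 0 | Some _ \<Rightarrow> 1)"
    "regs s2 (rw R) = (case edge u v of None \<Rightarrow> 0 | Some w \<Rightarrow> int w)" "mem s2 = mem s"
    using link_correct[OF d(2,4,5) _ _ d(6,7)] u v d(3,8) by (auto simp: s2_def edge_def)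
  have cells: "regs s2 (rb R) = cell (2 * i)" "regs s2 (rw R) = cell (Suc (2 * i))"
    unfolding l cell_def u_def v_def by (auto split: option.split)
  have i: "int i < 225 * (int n * int n)" using assms(1) by (simp flip: of_nat_mult)
  have a: "nat (450 * (int n * int n) + 1 + 2 * int i) = 450 * (n * n) + 1 + 2 * i"
    "nat (450 * (int n * int n) + 1 + 2 * int i + 1) = 450 * (n * n) + 1 + 2 * i + 1"
    by (simp_all add: nat_add_distrib nat_mult_distrib)
  have F: "regs s2 (rF R) = 450 * (int n * int n) + 1" using l(2) by (simp add: params_def)
  have "safe W (write_stm R) s2"
    using l(3) F cell_less[of "2 * i"] cell_less[of "Suc (2 * i)"]
    by (simp add: write_stm_def cells; intro conjI; use b i in linarith)
  moreover define s3 where "s3 = sem (write_stm R) s2"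
  have s3: "params s3" "regs s3 (re R) = int (Suc i)"
    "mem s3 = (mem s)(450 * (n * n) + 1 + 2 * i := cell (2 * i),
       450 * (n * n) + 1 + 2 * i + 1 := cell (Suc (2 * i)))"
  proof -
    show "params s3" "regs s3 (re R) = int (Suc i)"
      using l(2,3) by (simp_all add: s3_def write_stm_def params_def)
    show "mem s3 = (mem s)(450 * (n * n) + 1 + 2 * i := cell (2 * i),
       450 * (n * n) + 1 + 2 * i + 1 := cell (Suc (2 * i)))"
      unfolding s3_def write_stm_def sem.simps aval.simps eval_binop.simps
      using a F by (simp add: cells l(3,6))
  qed
  have "build_inv (Suc i) s3"
    unfolding build_inv_def
  proof (intro conjI allI)
    fix a
    consider "a = 450 * (n * n) + 1 + 2 * i" | "a = 450 * (n * n) + 1 + 2 * i + 1"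
      | "a \<le> 450 * (n * n) + 2 * i" | "450 * (n * n) + 2 * i + 2 < a" by linarith
    then show "mem s3 a = (if 450 * (n * n) < a \<and> a \<le> 450 * (n * n) + 2 * Suc i
        then cell (a - (450 * (n * n) + 1)) else input a)"
      using assms(2) by cases (simp_all add: s3 build_inv_def)
  qed (use s3 in auto)
  ultimately show ?thesis
    using d(1) l(1) by (simp add: build_stm_def s1_def s2_def s3_def)
qed

definition move_inv :: "nat \<Rightarrow> state \<Rightarrow> bool" where
  "move_inv i s \<longleftrightarrow> params s \<and> regs s (re R) = int i \<and> regs s (rt R) = 450 * (int n * int n) \<and>
     (\<forall>a. mem s a = (if 0 < a \<and> a \<le> i then cell (a - 1)
        else if 450 * (n * n) < a \<and> a \<le> 450 * (n * n) + i then 0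
        else if 450 * (n * n) < a \<and> a \<le> 900 * (n * n) then cell (a - (450 * (n * n) + 1))
        else input a))"

text \<open>The target \<open>i + 1 \<le> 450 * (n * n)\<close> lies below every source cell, so no
  unread word is overwritten.\<close>

lemma move_step:
  assumes "i < 450 * (n * n)" "move_inv i s"
  shows "safe W (move_stm R) s \<and> move_inv (Suc i) (sem (move_stm R) s)"
proof -
  note b = bounds W
  have i: "int i < 450 * (int n * int n)" using assms(1) by (simp flip: of_nat_mult)
  have s: "params s" "regs s (re R) = int i" "regs s (rt R) = 450 * (int n * int n)"
    using assms(2) by (auto simp: move_inv_def)
  have F: "regs s (rF R) = 450 * (int n * int n) + 1" using s(1) by (simp add: params_def)
  have a: "nat (450 * (int n * int n) + 1 + int i) = 450 * (n * n) + 1 + i" "nat (int i + 1) = i + 1"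
    by (simp_all add: nat_add_distrib nat_mult_distrib)
  have m: "mem s (450 * (n * n) + 1 + i) = cell i" using assms by (simp add: move_inv_def)
  have "safe W (move_stm R) s"
    using cell_less[of i]
    by (simp add: move_stm_def s F a m[simplified]; intro conjI; use b i in linarith)
  moreover define s3 where "s3 = sem (move_stm R) s"
  have s3: "params s3" "regs s3 (re R) = int (Suc i)" "regs s3 (rt R) = 450 * (int n * int n)"
    "mem s3 = (mem s)(i + 1 := cell i, 450 * (n * n) + 1 + i := 0)"
  proof -
    show "params s3" "regs s3 (re R) = int (Suc i)" "regs s3 (rt R) = 450 * (int n * int n)"
      using s by (simp_all add: s3_def move_stm_def params_def)
    show "mem s3 = (mem s)(i + 1 := cell i, 450 * (n * n) + 1 + i := 0)"
      unfolding s3_def move_stm_def sem.simps aval.simps eval_binop.simps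
      using a m F by (simp add: s(2))
  qed
  have "move_inv (Suc i) s3"
    unfolding move_inv_def
  proof (intro conjI allI)
    fix a
    consider "a = i + 1" | "a = 450 * (n * n) + 1 + i"
      | "a \<noteq> i + 1" "a \<noteq> 450 * (n * n) + 1 + i" by linarith
    then show "mem s3 a = (if 0 < a \<and> a \<le> Suc i then cell (a - 1)
        else if 450 * (n * n) < a \<and> a \<le> 450 * (n * n) + Suc i then 0
        else if 450 * (n * n) < a \<and> a \<le> 900 * (n * n) then cell (a - (450 * (n * n) + 1))
        else input a)"
      using assms by cases (auto simp: s3 move_inv_def)
  qed (use s3 in auto)
  ultimately show ?thesis by (simp add: s3_def)
qed

lemma build_inv_agree: "agree (R + 22) s s' \<Longrightarrow> build_inv i s \<Longrightarrow> build_inv i s'"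
  unfolding build_inv_def using params_agree by (auto simp: agree_def)

lemma move_inv_agree: "agree (R + 22) s s' \<Longrightarrow> move_inv i s \<Longrightarrow> move_inv i s'"
  unfolding move_inv_def using params_agree by (auto simp: agree_def)

lemma runs_encode_com:
  assumes "\<forall>r. regs s r = 0" "mem s = input"
  shows "runs W (encode_com R) s
    (cost (setup_stm R) + (225 * (n * n) * Suc (cost (build_stm R)) + 1 +
      (cost (init_move_stm R) + (450 * (n * n) * Suc (cost (move_stm R)) + 1 + cost (header_stm R)))))
    (\<lambda>s. params s \<and> mem s = (\<lambda>a. if a = 0 then 15 * int n
       else if a \<le> 450 * (n * n) then cell (a - 1) else 0))"
  unfolding encode_com_def
proof (intro runs_Seq)
  have st: "safe W (setup_stm R) s \<and> build_inv 0 (sem (setup_stm R) s)"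
    using dims_correct[OF assms] derived_correct[of "sem (dims_stm R) s"]
    by (simp add: setup_stm_def build_inv_def)
  show "runs W (compile (rZ R) (setup_stm R)) s (cost (setup_stm R)) (build_inv 0)"
    by (rule runs_compile_inv[where Q = "build_inv 0", OF svars_stm(1) build_inv_agree st])
next
  fix s assume "build_inv 0 s"
  then show "runs W (While (Less (re R) (rE R)) (compile (rZ R) (build_stm R))) s
      (225 * (n * n) * Suc (cost (build_stm R)) + 1) (build_inv (225 * (n * n)))"
  proof (rule runs_While)
    fix i s assume i: "i < 225 * (n * n)" "build_inv i s"
    then have "int i < 225 * (int n * int n)" by (simp flip: of_nat_mult)
    then show "eval_test (Less (re R) (rE R)) s \<and>
      runs W (compile (rZ R) (build_stm R)) s (cost (build_stm R)) (build_inv (Suc i))"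
      using i runs_compile_inv[where Q = "build_inv (Suc i)", OF svars_stm(2) build_inv_agree build_step[OF i]]
      by (simp add: build_inv_def params_def)
  qed (auto simp: build_inv_def params_def)
next
  fix s assume s: "build_inv (225 * (n * n)) s"
  then have "safe W (init_move_stm R) s"
    using zero_le_square[of "int n"]
    by (simp add: init_move_stm_def build_inv_def params_def; intro conjI; use bounds W in linarith)
  moreover have "move_inv 0 (sem (init_move_stm R) s)"
    using s by (simp add: init_move_stm_def build_inv_def move_inv_def params_def)
  ultimately show "runs W (compile (rZ R) (init_move_stm R)) s (cost (init_move_stm R)) (move_inv 0)"
    by (intro runs_compile_inv[where Q = "move_inv 0", OF svars_stm(3) move_inv_agree] conjI)
next
  fix s assume "move_inv 0 s"
  then show "runs W (While (Less (re R) (rt R)) (compile (rZ R) (move_stm R))) s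
      (450 * (n * n) * Suc (cost (move_stm R)) + 1) (move_inv (450 * (n * n)))"
  proof (rule runs_While)
    fix i s assume i: "i < 450 * (n * n)" "move_inv i s"
    then have "int i < 450 * (int n * int n)" by (simp flip: of_nat_mult)
    then show "eval_test (Less (re R) (rt R)) s \<and>
      runs W (compile (rZ R) (move_stm R)) s (cost (move_stm R)) (move_inv (Suc i))"
      using i runs_compile_inv[where Q = "move_inv (Suc i)", OF svars_stm(4) move_inv_agree move_step[OF i]]
      by (simp add: move_inv_def)
  qed (auto simp: move_inv_def)
next
  fix s assume s: "move_inv (450 * (n * n)) s"
  have "safe W (header_stm R) s" using s
    by (simp add: header_stm_def move_inv_def params_def; intro conjI; use bounds W in linarith)
  then show "runs W (compile (rZ R) (header_stm R)) s (cost (header_stm R))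
    (\<lambda>s. params s \<and> mem s = (\<lambda>a. if a = 0 then 15 * int n
       else if a \<le> 450 * (n * n) then cell (a - 1) else 0))"
  proof (rule runs_compile_post[OF svars_stm(5)])
    fix s' assume a: "agree (rZ R) (sem (header_stm R) s) s'"
    have "params (sem (header_stm R) s)" using s by (simp add: header_stm_def params_def move_inv_def)
    with a have "params s'" by (rule params_agree)
    \<comment> \<open>Behind the final matrix, the cells of the first copy were cleared by the move
      and all later ones are zero by \<open>input_end\<close>.\<close>
    moreover have "mem s' x = (if x = 0 then 15 * int n
       else if x \<le> 450 * (n * n) then cell (x - 1) else 0)" for x
      using a s input_end[of x]
      by (auto simp: header_stm_def params_def move_inv_def agree_def)
    ultimately show "params s' \<and> mem s' = (\<lambda>a. if a = 0 then 15 * int n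
       else if a \<le> 450 * (n * n) then cell (a - 1) else 0)" by auto
  qed
qed

definition read_inv :: "(nat \<Rightarrow> int) \<Rightarrow> nat \<Rightarrow> state \<Rightarrow> bool" where
  "read_inv m i s \<longleftrightarrow> regs s (rn R) = int n \<and> regs s (rK R) = int K \<and> regs s (rN R) = 15 * int n \<and>
     regs s (re R) = int i \<and> regs s (rt R) = int n * int n \<and>
     (\<forall>a. mem s a = (if a < i then int (min_sum (a div n) (a mod n)) - 2 * int K else m a))"

lemma read_inv_agree: "agree (R + 22) s s' \<Longrightarrow> read_inv m i s \<Longrightarrow> read_inv m i s'"
  unfolding read_inv_def by (auto simp: agree_def)

lemma read_step:
  assumes "i < n * n" "read_inv m i s"
    and m: "\<And>i j. i < n \<Longrightarrow> j < n \<Longrightarrow>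
      m (2 * (i * (15 * n) + (n + j)) + 1) = int (12 * K + min_sum i j)"
  shows "safe W (read_stm R) s \<and> read_inv m (Suc i) (sem (read_stm R) s)"
proof -
  note b = bounds W
  define u v where "u = i div n" and "v = i mod n"
  have v: "v < n" using n by (simp add: v_def)
  have u: "u < n" unfolding u_def using assms(1) by (simp add: less_mult_imp_div_less)
  have i: "int i < int n * int n" using assms(1) by (simp flip: of_nat_mult)
  have uv: "int i div int n = int u" "int i mod int n = int v"
    by (simp_all add: u_def v_def of_nat_div of_nat_mod)
  have iuv: "i = u * n + v" by (simp add: u_def v_def)
  have "u * n \<le> n * n" using u by simp
  then have un: "int u * int n \<le> int n * int n" "0 \<le> int u * int n"
    by (simp_all flip: of_nat_mult)
  have s: "regs s (rn R) = int n" "regs s (rK R) = int K" "regs s (rN R) = 15 * int n"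
     "regs s (re R) = int i" "regs s (rt R) = int n * int n"
    using assms(2) by (auto simp: read_inv_def)
  let ?a = "2 * (u * (15 * n) + (n + v)) + 1"
  have a: "nat (2 * (int u * (15 * int n) + (int n + int v)) + 1) = ?a"
    by (simp add: nat_add_distrib nat_mult_distrib)
  \<comment> \<open>Index \<open>0\<close> is a candidate for the minimum, and its two shifted
    entries are at most \<open>2 * K\<close> each.\<close>
  have ms: "min_sum u v \<le> 4 * K"
    using min_sum_le[OF K(1), of u v] \<alpha>[OF u K(1)] \<beta>[OF K(1) v] by simp
  have "i < ?a" unfolding iuv by simp
  then have ma: "mem s ?a = int (12 * K + min_sum u v)"
    using assms(2) m[OF u v] by (simp add: read_inv_def)
  have ua: "int u < int n" "int v < int n" "int (min_sum u v) \<le> 4 * int K" using u v ms by auto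
  have "30 * (int u * int n) + 2 * int n + 2 * int v + 1 < W" using b un ua by linarith
  then have addr: "2 * (int u * (15 * int n) + (int n + int v)) + 1 < W" by (simp add: algebra_simps)
  then have addr': "2 * (int u * (15 * int n) + (int n + int v)) < W" by linarith
  \<comment> \<open>Without \<open>distrib_left_numeral\<close> the address keeps the product form
    in which \<open>a\<close> and \<open>addr\<close> state it.\<close>
  have "safe W (read_stm R) s"
    unfolding read_stm_def
    by (simp add: s uv a ma[folded Suc_eq_plus1] del: distrib_left_numeral;
        intro conjI; use b i un ua addr addr' in linarith)
  moreover define s3 where "s3 = sem (read_stm R) s"
  have s3: "regs s3 (rn R) = int n" "regs s3 (rK R) = int K" "regs s3 (rN R) = 15 * int n"
     "regs s3 (re R) = int (Suc i)" "regs s3 (rt R) = int n * int n"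
    "mem s3 = (mem s)(i := int (min_sum u v) - 2 * int K)"
  proof -
    show "regs s3 (rn R) = int n" "regs s3 (rK R) = int K" "regs s3 (rN R) = 15 * int n"
     "regs s3 (re R) = int (Suc i)" "regs s3 (rt R) = int n * int n"
      using s by (simp_all add: s3_def read_stm_def)
    have "mem s3 = (mem s)(nat (int i) :=
        mem s (nat (2 * (int u * (15 * int n) + (int n + int v)) + 1)) - 14 * int K)"
      by (simp add: s3_def read_stm_def s uv del: distrib_left_numeral)
    then show "mem s3 = (mem s)(i := int (min_sum u v) - 2 * int K)"
      unfolding a ma by simp
  qed
  have "read_inv m (Suc i) s3"
    unfolding read_inv_def using s3 assms(2) by (auto simp: read_inv_def u_def v_def less_Suc_eq)
  ultimately show ?thesis by (simp add: s3_def)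
qed

lemma runs_decode_com:
  assumes "regs s (rn R) = int n" "regs s (rK R) = int K" "regs s (rN R) = 15 * int n"
    and m: "\<And>i j. i < n \<Longrightarrow> j < n \<Longrightarrow>
      mem s (2 * (i * (15 * n) + (n + j)) + 1) = int (12 * K + min_sum i j)"
  shows "runs W (decode_com R) s
    (cost (init_read_stm R) + (n * n * Suc (cost (read_stm R)) + 1))
    (\<lambda>s. \<forall>i<n. \<forall>j<n. mem s (i * n + j) = int (min_sum i j) - 2 * int K)"
  unfolding decode_com_def
proof (rule runs_Seq)
  have "safe W (init_read_stm R) s"
    using assms(1-3) zero_le_square[of "int n"]
    by (simp add: init_read_stm_def; intro conjI; use bounds W in linarith)
  moreover have "read_inv (mem s) 0 (sem (init_read_stm R) s)"
    using assms(1-3) by (simp add: init_read_stm_def read_inv_def)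
  ultimately show "runs W (compile (rZ R) (init_read_stm R)) s (cost (init_read_stm R))
      (read_inv (mem s) 0)"
    by (intro runs_compile_inv[where Q = "read_inv (mem s) 0", OF svars_stm(6) read_inv_agree] conjI)
next
  fix s1 assume "read_inv (mem s) 0 s1"
  then have "runs W (While (Less (re R) (rt R)) (compile (rZ R) (read_stm R))) s1
      (n * n * Suc (cost (read_stm R)) + 1) (read_inv (mem s) (n * n))"
  proof (rule runs_While)
    fix i s1 assume i: "i < n * n" "read_inv (mem s) i s1"
    then have "int i < int n * int n" by (simp flip: of_nat_mult)
    moreover have "safe W (read_stm R) s1 \<and> read_inv (mem s) (Suc i) (sem (read_stm R) s1)"
      by (rule read_step[OF i]) (rule m)
    note runs_compile_inv[where Q = "read_inv (mem s) (Suc i)", OF svars_stm(7) read_inv_agree this]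
    ultimately show "eval_test (Less (re R) (rt R)) s1 \<and>
      runs W (compile (rZ R) (read_stm R)) s1 (cost (read_stm R)) (read_inv (mem s) (Suc i))"
      using i by (simp add: read_inv_def)
  qed (auto simp: read_inv_def)
  moreover have "mem s2 (i * n + j) = int (min_sum i j) - 2 * int K"
    if "read_inv (mem s) (n * n) s2" "i < n" "j < n" for s2 i j
  proof -
    have "i * n + j < n * n" using mult_le_mono1[of "Suc i" n n] that by simp
    then show ?thesis using that by (simp add: read_inv_def)
  qed
  ultimately show "runs W (While (Less (re R) (rt R)) (compile (rZ R) (read_stm R))) s1
      (n * n * Suc (cost (read_stm R)) + 1)
      (\<lambda>s. \<forall>i<n. \<forall>j<n. mem s (i * n + j) = int (min_sum i j) - 2 * int K)"
    unfolding runs_def by blast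
qed

end

section \<open>The lower bound\<close>

lemma length_concat_uniform:
  assumes "\<And>i. i < m \<Longrightarrow> length (f i) = l"
  shows "length (concat (map f [0..<m])) = m * l"
  using assms by (induction m) auto

lemma nth_concat_uniform:
  assumes "\<And>i. i < m \<Longrightarrow> length (f i) = l" "c < m * l"
  shows "concat (map f [0..<m]) ! c = f (c div l) ! (c mod l)"
  using assms
proof (induction m)
  case (Suc m)
  have len: "length (concat (map f [0..<m])) = m * l"
    using Suc.prems by (intro length_concat_uniform) auto
  show ?case
  proof (cases "c < m * l")
    case True
    with Suc len show ?thesis by (simp add: nth_append)
  next
    case False
    have "c div l = m"
      using False Suc.prems(2) by (intro div_nat_eqI) (simp_all add: mult.commute)
    moreover from this have "c mod l = c - m * l"
      using minus_mult_div_eq_mod[of c l] by (simp add: mult.commute)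
    ultimately show ?thesis using False Suc.prems(2) len by (simp add: nth_append)
  qed
qed simp

lemma length_row_major: "A \<in> carrier_mat m l \<Longrightarrow> length (row_major A) = m * l"
  unfolding row_major_def by (subst length_concat_uniform[of _ _ l]) auto

lemma nth_row_major:
  assumes "A \<in> carrier_mat m l" "i < m" "j < l"
  shows "row_major A ! (i * l + j) = A $$ (i, j)"
proof -
  let ?f = "\<lambda>i. map (\<lambda>j. A $$ (i, j)) [0..<l]"
  have r: "row_major A = concat (map ?f [0..<m])" using assms(1) by (auto simp: row_major_def)
  have "i * l + j < m * l" using mult_le_mono1[of "Suc i" m l] assms(2,3) by simp
  then have "row_major A ! (i * l + j) = ?f ((i * l + j) div l) ! ((i * l + j) mod l)"
    unfolding r by (intro nth_concat_uniform) auto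
  then show "row_major A ! (i * l + j) = A $$ (i, j)" using assms(3) by simp
qed

context reduction
begin

text \<open>The right-hand side is the memory left by \<open>encode_com\<close>, so the APSP
  algorithm can be started there as if on its own input.\<close>

lemma mem_apsp_input:
  "mem (init_state (apsp_input (graph, weight))) =
     (\<lambda>a. if a = 0 then 15 * int n else if a \<le> 450 * (n * n) then cell (a - 1) else 0)"
proof -
  let ?N = "15 * n"
  let ?e = "\<lambda>u v. if (u, v) \<in> parcs graph then [1, weight (u, v)] else [0, 0]"
  let ?r = "\<lambda>u. concat (map (?e u) [0..<?N])"
  have inp: "apsp_input (graph, weight) = int ?N # concat (map ?r [0..<?N])"
    by (simp add: graph_def Let_def)
  have e: "length (?e u v) = 2" for u v by simp
  have r: "length (?r u) = ?N * 2" for u by (rule length_concat_uniform) (rule e)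
  have len: "length (concat (map ?r [0..<?N])) = ?N * (?N * 2)"
    by (rule length_concat_uniform) (rule r)
  have "concat (map ?r [0..<?N]) ! c = cell c" if "c < ?N * (?N * 2)" for c
  proof -
    define u v where "u = c div 2 div ?N" and "v = c div 2 mod ?N"
    have uv: "u < ?N" "v < ?N"
      using that n by (auto simp: u_def v_def less_mult_imp_div_less mult.assoc)
    \<comment> \<open>Indexing goes through two levels of equal blocks: rows of \<open>2 * N\<close>
      words, and pairs of two words within a row.\<close>
    have "concat (map ?r [0..<?N]) ! c = ?r (c div (?N * 2)) ! (c mod (?N * 2))"
      by (rule nth_concat_uniform[OF r that])
    also have "c div (?N * 2) = u" by (simp only: u_def mult.commute[of ?N 2] div_mult2_eq)
    also have "c mod (?N * 2) = 2 * v + c mod 2"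
      by (simp only: v_def mult.commute[of ?N 2] mod_mult2_eq)
    also have "?r u ! (2 * v + c mod 2) = ?e u ((2 * v + c mod 2) div 2) ! ((2 * v + c mod 2) mod 2)"
      using uv by (intro nth_concat_uniform[OF e]) auto
    also have "\<dots> = ?e u v ! (c mod 2)" by simp
    also have "\<dots> = cell c"
      using uv by (cases "edge u v"; cases "even c")
        (auto simp: cell_def graph_def weight_def u_def v_def odd_iff_mod_2_eq_one)
    finally show ?thesis .
  qed
  then show ?thesis unfolding inp
    by (auto simp: init_state_def len nth_Cons' fun_eq_iff simp del: map_map)
qed

text \<open>After encoding, the state agrees with the initial state of \<open>P\<close> on memory
  and on the registers below \<open>R\<close>. By \<open>exec_frame\<close>, \<open>P\<close> then
  runs as usual and leaves the parameters for decoding intact.\<close>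

lemma runs_reduction:
  assumes regs: "com_regs P \<subseteq> {..<R}"
    and P: "exec W P (init_state (apsp_input (graph, weight))) t s'"
    and correct: "apsp_correct (graph, weight) (mem s')"
    and s: "\<forall>r. regs s r = 0" "mem s = input"
  shows "runs W (Seq (encode_com R) (Seq P (decode_com R))) s
    (cost (setup_stm R) + (225 * (n * n) * Suc (cost (build_stm R)) + 1 +
      (cost (init_move_stm R) + (450 * (n * n) * Suc (cost (move_stm R)) + 1 + cost (header_stm R)))) +
     (t + (cost (init_read_stm R) + (n * n * Suc (cost (read_stm R)) + 1))))
    (\<lambda>s. \<forall>i<n. \<forall>j<n. mem s (i * n + j) = int (min_sum i j) - 2 * int K)"
proof (rule runs_Seq[OF runs_encode_com[OF s]], rule runs_Seq)
  fix s1 assume s1: "params s1 \<and> mem s1 = (\<lambda>a. if a = 0 then 15 * int n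
       else if a \<le> 450 * (n * n) then cell (a - 1) else 0)"
  then have "agree R (init_state (apsp_input (graph, weight))) s1"
    unfolding agree_def mem_apsp_input by (simp add: params_def init_state_def)
  from exec_frame[OF P regs this]
  show "runs W P s1 t (\<lambda>s. mem s = mem s' \<and> (\<forall>r\<ge>R. regs s r = regs s1 r))"
    unfolding runs_def agree_def by blast
  fix s2 :: state assume s2: "mem s2 = mem s' \<and> (\<forall>r\<ge>R. regs s2 r = regs s1 r)"
  show "runs W (decode_com R) s2 (cost (init_read_stm R) + (n * n * Suc (cost (read_stm R)) + 1))
    (\<lambda>s. \<forall>i<n. \<forall>j<n. mem s (i * n + j) = int (min_sum i j) - 2 * int K)"
  proof (rule runs_decode_com)
    show "regs s2 (rn R) = int n" "regs s2 (rK R) = int K" "regs s2 (rN R) = 15 * int n"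
      using s1 s2 by (simp_all add: params_def)
    fix i j assume ij: "i < n" "j < n"
    have "card (pverts graph) = 15 * n" by (simp add: graph_def)
    then have all: "\<forall>u<15 * n. \<forall>v<15 * n. decode_distance (mem s' (2 * (u * (15 * n) + v)))
        (mem s' (2 * (u * (15 * n) + v) + 1)) (distance graph weight u v)"
      using correct by (simp only: apsp_correct.simps Let_def)
    have "i < 15 * n" "n + j < 15 * n" using ij by auto
    with all have "decode_distance (mem s' (2 * (i * (15 * n) + (n + j))))
        (mem s' (2 * (i * (15 * n) + (n + j)) + 1)) (distance graph weight i (n + j))"
      by blast
    \<comment> \<open>The distance is finite, so the flag must be \<open>1\<close> and the second
      word is the distance itself.\<close>
    then show "mem s2 (2 * (i * (15 * n) + (n + j)) + 1) = int (12 * K + min_sum i j)"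
      unfolding distance_graph[OF ij] decode_distance_def using s2 by auto
  qed
qed

end

text \<open>
  The quotient \<open>K * K div n\<close> approximates \<open>n powr \<gamma>\<close> up to a constant factor. The program can compute
  it from the dimensions in its input, whereas \<open>\<gamma>\<close> may be an uncomputable real number.
\<close>

lemma gadget_parameters:
  fixes n K :: nat
  assumes "0 < K" "K \<le> n"
  defines "D \<equiv> max 1 (K * K div n - 1)"
  defines "L \<equiv> 2 * K div D"
  shows "0 < D" "D \<le> K" "2 * n + K * Suc (2 * L) \<le> 15 * n"
proof -
  have n: "0 < n" using assms by simp
  show D: "0 < D" by (simp add: D_def)
  have "K * K div n \<le> K * n div n" using assms by (intro div_le_mono) simp
  then show "D \<le> K" using assms n by (simp add: D_def)
  \<comment> \<open>The factor \<open>3\<close> is attained when the quotient is \<open>2\<close>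
    and hence \<open>D = 1\<close>.\<close>
  have "K * K div n + 1 \<le> 3 * D" unfolding D_def by linarith
  then have "n * (K * K div n + 1) \<le> n * (3 * D)" by (rule mult_le_mono2)
  moreover have "K * K < n * (K * K div n + 1)"
    using dividend_less_times_div[OF n, of "K * K"] by (simp add: algebra_simps)
  ultimately have KK: "K * K \<le> 3 * n * D" by (simp add: algebra_simps)
  have "L * D \<le> 2 * K" unfolding L_def by (rule div_times_less_eq_dividend)
  then have "K * (L * D) \<le> K * (2 * K)" by (rule mult_le_mono2)
  also have "K * (2 * K) \<le> 6 * n * D" using KK by linarith
  finally have "(K * L) * D \<le> (6 * n) * D" by (simp only: mult.assoc)
  then have "K * L \<le> 6 * n" using D by simp
  \<comment> \<open>The \<open>15\<close> arises as \<open>2 * n\<close> outer vertices plus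
    \<open>K + 2 * K * L \<le> n + 12 * n\<close> chain vertices.\<close>
  then show "2 * n + K * Suc (2 * L) \<le> 15 * n" using assms(2) by (simp add: algebra_simps)
qed

text \<open>As \<open>n + 2 \<ge> 2\<close>, the factor \<open>16\<close> costs four powers and
  \<open>1024\<close> costs ten. Hence five powers per unit of \<open>c\<close> for the larger
  vertex number, and \<open>10 + 2\<close> for the addresses.\<close>

lemma word_bounds:
  fixes n c :: nat
  assumes "1 \<le> n"
  shows "(int (15 * n) + 2) ^ c \<le> (int n + 2) ^ (5 * c + 12)"
    and "1000 * (int n * int n) + 1000 < (int n + 2) ^ (5 * c + 12)"
proof -
  let ?x = "int n + 2"
  have x: "1 \<le> ?x" "2 \<le> ?x" by auto
  have 4: "16 \<le> ?x ^ 4" using power_mono[OF x(2), of 4] by simp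
  have "int (15 * n) + 2 \<le> 16 * ?x" by simp
  also have "\<dots> \<le> ?x ^ 4 * ?x" using 4 by (rule mult_right_mono) simp
  also have "\<dots> = ?x ^ 5" by (simp add: power_Suc2[symmetric] del: power_Suc)
  finally have "(int (15 * n) + 2) ^ c \<le> (?x ^ 5) ^ c" by (intro power_mono) auto
  also have "\<dots> = ?x ^ (5 * c)" by (simp add: power_mult)
  also have "\<dots> \<le> ?x ^ (5 * c + 12)" using x(1) by (intro power_increasing) auto
  finally show "(int (15 * n) + 2) ^ c \<le> ?x ^ (5 * c + 12)" .
  have "1000 * (int n * int n) + 1000 < 1024 * (?x * ?x)"
    by (simp add: algebra_simps add_strict_increasing2)
  also have "\<dots> \<le> ?x ^ 10 * (?x * ?x)"
    using power_mono[OF x(2), of 10] by (intro mult_right_mono) auto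
  also have "\<dots> = ?x ^ 12" by (simp add: eval_nat_numeral)
  also have "\<dots> \<le> ?x ^ (5 * c + 12)" using x(1) by (intro power_increasing) auto
  finally show "1000 * (int n * int n) + 1000 < ?x ^ (5 * c + 12)" .
qed

text \<open>The exponents add up as \<open>\<gamma> / 2 + 5 / 2 - \<epsilon> = 2 + (1 + \<gamma>) /
  2 - \<epsilon>\<close>, and \<open>sqrt 2\<close> pays for the maximum in
  \<open>num_weights\<close>. Capping \<epsilon> at \<open>1 / 2\<close> keeps the final exponent at
  least \<open>2\<close>, which the quadratic overhead requires.\<close>

lemma apsp_time_le:
  fixes \<gamma> \<epsilon> :: real and n :: nat
  assumes "0 \<le> \<gamma>" "1 \<le> n"
  shows "sqrt (num_weights \<gamma> (15 * n)) * real (15 * n) powr (5/2 - \<epsilon>)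
    \<le> sqrt 2 * 15 powr (2 + (1 + \<gamma>) / 2 - \<epsilon>) * real n powr (2 + (1 + \<gamma>) / 2 - min \<epsilon> (1/2))"
proof -
  let ?N = "real (15 * n)"
  have N: "1 \<le> ?N" using assms by simp
  have "1 \<le> ?N powr \<gamma>" using N assms by (simp add: ge_one_powr_ge_zero)
  then have "num_weights \<gamma> (15 * n) \<le> 2 * ?N powr \<gamma>" unfolding num_weights_def by simp
  then have "sqrt (num_weights \<gamma> (15 * n)) \<le> sqrt (2 * ?N powr \<gamma>)" by (rule real_sqrt_le_mono)
  also have "\<dots> = sqrt 2 * ?N powr (\<gamma> / 2)"
    by (simp add: real_sqrt_mult powr_half_sqrt[symmetric] powr_powr)
  finally have "sqrt (num_weights \<gamma> (15 * n)) * ?N powr (5/2 - \<epsilon>)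
      \<le> sqrt 2 * ?N powr (\<gamma> / 2) * ?N powr (5/2 - \<epsilon>)"
    by (rule mult_right_mono) simp
  also have "\<dots> = sqrt 2 * ?N powr (2 + (1 + \<gamma>) / 2 - \<epsilon>)"
    by (simp add: mult.assoc powr_add[symmetric] field_simps del: of_nat_mult)
  also have "\<dots> = sqrt 2 * 15 powr (2 + (1 + \<gamma>) / 2 - \<epsilon>) * real n powr (2 + (1 + \<gamma>) / 2 - \<epsilon>)"
    by (simp add: powr_mult)
  also have "\<dots> \<le> sqrt 2 * 15 powr (2 + (1 + \<gamma>) / 2 - \<epsilon>)
      * real n powr (2 + (1 + \<gamma>) / 2 - min \<epsilon> (1/2))"
    using assms by (intro mult_left_mono powr_mono) auto
  finally show ?thesis .
qed

text \<open>The left-hand side is \<open>max 2 (K * K div n)\<close>, and \<open>K * K / n\<close>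
  is at most \<open>n powr \<gamma>\<close> by the choice of \<open>K\<close>.\<close>

lemma card_weights_le_num_weights:
  fixes \<gamma> :: real
  assumes "0 \<le> \<gamma>" "1 \<le> n" "real K \<le> real n powr ((1 + \<gamma>) / 2)"
  shows "real (max 1 (K * K div n - 1) + 1) \<le> num_weights \<gamma> (15 * n)"
proof -
  have "real (K * K div n) \<le> real (K * K) / real n" by (rule of_nat_div_le_of_nat)
  also have "\<dots> \<le> (real n powr ((1 + \<gamma>) / 2) * real n powr ((1 + \<gamma>) / 2)) / real n"
    unfolding of_nat_mult using assms by (intro divide_right_mono mult_mono) auto
  also have "\<dots> = real n powr \<gamma>"
  proof -
    have "real n powr ((1 + \<gamma>) / 2) * real n powr ((1 + \<gamma>) / 2) = real n powr (1 + \<gamma>)"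
      by (simp flip: powr_add)
    also have "\<dots> = real n * real n powr \<gamma>" using assms(2) by (simp add: powr_add)
    finally show ?thesis using assms(2) by simp
  qed
  also have "\<dots> \<le> real (15 * n) powr \<gamma>" using assms by (intro powr_mono2) auto
  finally show ?thesis unfolding num_weights_def by (auto simp: max_def)
qed

lemma min_plus_solvable:
  fixes \<gamma> \<epsilon> :: real
  assumes "0 \<le> \<gamma>" "\<gamma> \<le> 1"
    and "apsp_solvable_in_time
      (\<lambda>n. undirected_graphs n \<inter> few_weights (num_weights \<gamma> n))
      (\<lambda>n. sqrt (num_weights \<gamma> n) * real n powr (5/2 - \<epsilon>))"
  defines "\<beta> \<equiv> (1 + \<gamma>) / 2"
  shows "solvable_in_time
    (\<lambda>n. min_plus_instances n (nat \<lfloor>real n powr \<beta>\<rfloor>) n (real n powr \<beta>))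
    min_plus_input min_plus_correct (\<lambda>n. real n powr (2 + \<beta> - min \<epsilon> (1/2)))"
proof -
  let ?T = "\<lambda>n. sqrt (num_weights \<gamma> n) * real n powr (5/2 - \<epsilon>)"
  \<comment> \<open>The weight bound is used with exponent \<open>1\<close>; the \<open>c\<close>
    obtained here belongs to the word size.\<close>
  obtain P c and C :: real where P: "\<And>n x. n \<ge> 1 \<Longrightarrow>
      x \<in> {(G, w) \<in> undirected_graphs n \<inter> few_weights (num_weights \<gamma> n).
        \<forall>e\<in>parcs G. \<bar>w e\<bar> \<le> int n ^ 1} \<Longrightarrow>
      \<exists>t s. exec ((int n + 2) ^ c) P (init_state (apsp_input x)) t s \<and>
        real t \<le> C * ?T n \<and> apsp_correct x (mem s)"
    using assms(3) unfolding apsp_solvable_in_time_def solvable_in_time_def by meson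
  obtain R where R: "com_regs P \<subseteq> {..<R}"
    using finite_com_regs[of P] finite_nat_bounded by blast
  \<comment> \<open>The cost of encoding and decoding per \<open>n * n\<close>; it depends on the
    algorithm only through \<open>R\<close>.\<close>
  define c0 where "c0 = cost (setup_stm R) + (225 * Suc (cost (build_stm R)) + 1 +
      (cost (init_move_stm R) + (450 * Suc (cost (move_stm R)) + 1 + cost (header_stm R)))) +
     (cost (init_read_stm R) + (Suc (cost (read_stm R)) + 1))"
  define C' where "C' = real c0 + \<bar>C\<bar> * (sqrt 2 * 15 powr (2 + \<beta> - \<epsilon>))"
  let ?P = "Seq (encode_com R) (Seq P (decode_com R))"
  have "\<exists>t s. exec ((int n + 2) ^ (5 * c + 12)) ?P (init_state (min_plus_input (A, B))) t s \<and>
      real t \<le> C' * real n powr (2 + \<beta> - min \<epsilon> (1/2)) \<and> min_plus_correct (A, B) (mem s)"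
    if n1: "n \<ge> 1"
      and AB: "(A, B) \<in> min_plus_instances n (nat \<lfloor>real n powr \<beta>\<rfloor>) n (real n powr \<beta>)" for n A B
  proof -
    define K where "K = nat \<lfloor>real n powr \<beta>\<rfloor>"
    define D where "D = max 1 (K * K div n - 1)"
    define L where "L = 2 * K div D"
    define a where "a i k = nat (A $$ (i, k) + int K)" for i k
    define b where "b k j = nat (B $$ (k, j) + int K)" for k j
    define W where "W = (int n + 2) ^ (5 * c + 12)"
    define s0 where "s0 = init_state (min_plus_input (A, B))"
    have b01: "0 \<le> \<beta>" "\<beta> \<le> 1" using assms(1,2) by (auto simp: \<beta>_def)
    have "1 \<le> real n powr \<beta>" using n1 b01 by (simp add: ge_one_powr_ge_zero)
    moreover have "real n powr \<beta> \<le> real n powr 1" using n1 b01 by (intro powr_mono) auto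
    ultimately have K: "0 < K" "K \<le> n" and Kr: "real K \<le> real n powr \<beta>"
      unfolding K_def using n1 by (simp_all add: le_nat_iff nat_le_iff floor_le_iff)
    have dims: "A \<in> carrier_mat n K" "B \<in> carrier_mat K n"
      using AB by (auto simp: min_plus_instances_def K_def)
    \<comment> \<open>Entries are integers, so the real bound sharpens to its floor
      \<open>K\<close>, and shifting by \<open>K\<close> gives naturals up to
      \<open>2 * K\<close>.\<close>
    have entry: "\<bar>z\<bar> \<le> int K" if "real_of_int \<bar>z\<bar> \<le> real n powr \<beta>" for z
    proof -
      have "\<bar>z\<bar> \<le> \<lfloor>real n powr \<beta>\<rfloor>" using that by (simp add: le_floor_iff)
      then show ?thesis unfolding K_def by linarith
    qed
    have A: "\<bar>A $$ (i, k)\<bar> \<le> int K" if "i < n" "k < K" for i k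
      using AB that by (intro entry) (auto simp: min_plus_instances_def K_def)
    have B: "\<bar>B $$ (k, j)\<bar> \<le> int K" if "k < K" "j < n" for k j
      using AB that by (intro entry) (auto simp: min_plus_instances_def K_def)
    have aA: "int (a i k) = A $$ (i, k) + int K" if "i < n" "k < K" for i k
      using A[OF that] by (simp add: a_def)
    have bB: "int (b k j) = B $$ (k, j) + int K" if "k < K" "j < n" for k j
      using B[OF that] by (simp add: b_def)
    let ?inp = "min_plus_input (A, B)"
    have inp: "?inp = [int n, int K, int n] @ row_major A @ row_major B" using dims by auto
    have lenA: "length (row_major A) = n * K" and lenB: "length (row_major B) = K * n"
      using dims by (simp_all add: length_row_major)
    interpret reduction n K D L a b R W "mem s0"
    proof
      show "0 < n" "0 < K" "K \<le> n" "L = 2 * K div D" "D = max 1 (K * K div n - 1)"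
        using n1 K by (auto simp: L_def D_def)
      show "0 < D" "D \<le> K" "2 * n + K * Suc (2 * L) \<le> 15 * n"
        using gadget_parameters[OF K] by (auto simp: L_def D_def)
      show "a i k \<le> 2 * K" if "i < n" "k < K" for i k using aA[OF that] A[OF that] by linarith
      show "b k j \<le> 2 * K" if "k < K" "j < n" for k j using bB[OF that] B[OF that] by linarith
      show "1000 * (int n * int n) + 1000 < W" unfolding W_def by (rule word_bounds(2)[OF n1])
      show "mem s0 0 = int n" "mem s0 1 = int K" unfolding s0_def inp by (simp_all add: init_state_def)
      show "mem s0 (3 + i * K + k) + int K = int (a i k)" if "i < n" "k < K" for i k
      proof -
        have "i * K + k < n * K" using mult_le_mono1[of "Suc i" n K] that by simp
        then show ?thesis unfolding aA[OF that] using nth_row_major[OF dims(1) that]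
          unfolding s0_def inp by (simp add: init_state_def lenA nth_append nth_Cons')
      qed
      show "mem s0 (3 + n * K + k * n + j) + int K = int (b k j)" if "k < K" "j < n" for k j
      proof -
        have "k * n + j < K * n" using mult_le_mono1[of "Suc k" K n] that by simp
        then show ?thesis unfolding bB[OF that] using nth_row_major[OF dims(2) that]
          unfolding s0_def inp by (simp add: init_state_def lenA lenB nth_append nth_Cons')
      qed
      show "mem s0 x = 0" if "450 * (n * n) < x" for x
      proof -
        have "n * K \<le> n * n" "K * n \<le> n * n" "0 < n * n" using K n1 by auto
        then have "3 + n * K + K * n \<le> x" using that by linarith
        moreover have "length ?inp = 3 + n * K + K * n" unfolding inp using lenA lenB by simp
        ultimately show ?thesis unfolding s0_def init_state_def by simp
      qed
    qed
    have "real (card (weight ` parcs graph)) \<le> real (D + 1)" using card_weights by simp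
    also have "\<dots> \<le> num_weights \<gamma> (15 * n)"
      unfolding D_def using card_weights_le_num_weights[OF assms(1) n1] Kr by (simp add: \<beta>_def)
    finally have "(graph, weight) \<in> {(G, w) \<in> undirected_graphs (15 * n) \<inter>
        few_weights (num_weights \<gamma> (15 * n)). \<forall>e\<in>parcs G. \<bar>w e\<bar> \<le> int (15 * n) ^ 1}"
      using graph_undirected weight_le by (simp add: few_weights_def)
    from P[OF _ this] n1 obtain t s where ts:
      "exec ((int (15 * n) + 2) ^ c) P (init_state (apsp_input (graph, weight))) t s"
      "real t \<le> C * ?T (15 * n)" "apsp_correct (graph, weight) (mem s)" by auto
    have P': "exec W P (init_state (apsp_input (graph, weight))) t s"
      unfolding W_def by (rule exec_word_bound_mono[OF ts(1) word_bounds(1)[OF n1]])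
    obtain t' s' where run: "exec W ?P s0 t' s'"
      "t' \<le> cost (setup_stm R) + (225 * (n * n) * Suc (cost (build_stm R)) + 1 +
      (cost (init_move_stm R) + (450 * (n * n) * Suc (cost (move_stm R)) + 1 + cost (header_stm R)))) +
     (t + (cost (init_read_stm R) + (n * n * Suc (cost (read_stm R)) + 1)))"
      "\<forall>i<n. \<forall>j<n. mem s' (i * n + j) = int (min_sum i j) - 2 * int K"
      using runs_reduction[OF R P' ts(3), of s0] unfolding runs_def by (auto simp: s0_def init_state_def)
    have "min_plus_correct (A, B) (mem s')"
    proof -
      have "int (min_sum i j) - 2 * int K = min_plus_product A B $$ (i, j)" if ij: "i < n" "j < n" for i j
      proof -
        have "min_plus_product A B $$ (i, j) = Min ((\<lambda>k. A $$ (i, k) + B $$ (k, j)) ` {..<K})"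
          using dims ij by (auto simp: min_plus_product_def)
        also have "\<dots> = int (min_sum i j) - 2 * int K"
        proof (rule Min_eqI)
          show "int (min_sum i j) - 2 * int K \<le> y"
            if y: "y \<in> (\<lambda>k. A $$ (i, k) + B $$ (k, j)) ` {..<K}" for y
          proof -
            obtain k where k: "k < K" "y = A $$ (i, k) + B $$ (k, j)" using y by auto
            then show ?thesis using min_sum_le[OF k(1), of i j] aA[OF ij(1) k(1)] bB[OF k(1) ij(2)]
              by linarith
          qed
          have "min_sum i j \<in> (\<lambda>k. a i k + b k j) ` {..<K}"
            unfolding min_sum_def using K by (intro Min_in) auto
          then obtain k where k: "k < K" "min_sum i j = a i k + b k j" by auto
          then have "int (min_sum i j) - 2 * int K = A $$ (i, k) + B $$ (k, j)"
            using aA[OF ij(1) k(1)] bB[OF k(1) ij(2)] by simp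
          then show "int (min_sum i j) - 2 * int K \<in> (\<lambda>k. A $$ (i, k) + B $$ (k, j)) ` {..<K}"
            using k(1) by blast
        qed simp
        finally show ?thesis ..
      qed
      then show ?thesis using run(3) dims by auto
    qed
    moreover have "real t' \<le> C' * real n powr (2 + \<beta> - min \<epsilon> (1/2))"
    proof -
      let ?p = "real n powr (2 + \<beta> - min \<epsilon> (1/2))"
      \<comment> \<open>With \<open>q = n * n \<ge> 1\<close>, all additive constants are absorbed
        into the quadratic term.\<close>
      have lin: "s + (225 * q * b + 1 + (im + (450 * q * m + 1 + h))) + (t + (ir + (q * r + 1)))
          \<le> q * (s + (225 * b + 1 + (im + (450 * m + 1 + h))) + (ir + (r + 1))) + t"
        if "1 \<le> q" for q s b im m h ir r :: nat
        using that by (cases q) (simp_all add: algebra_simps)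
      have "t' \<le> n * n * c0 + t"
        unfolding c0_def by (rule order_trans[OF run(2)], rule lin) (use n1 in simp)
      then have "real t' \<le> real (n * n) * real c0 + real t"
        by (simp flip: of_nat_mult of_nat_add)
      moreover have "real (n * n) \<le> ?p"
      proof -
        have "real (n * n) = real n powr 2" using n1 by (simp add: power2_eq_square)
        \<comment> \<open>Here \<open>min \<epsilon> (1/2) \<le> 1/2 \<le> \<beta>\<close> is
          used.\<close>
        also have "\<dots> \<le> ?p" using n1 assms(1) by (intro powr_mono) (auto simp: \<beta>_def)
        finally show ?thesis .
      qed
      then have "real (n * n) * real c0 \<le> ?p * real c0" by (rule mult_right_mono) simp
      moreover have "real t \<le> \<bar>C\<bar> * (sqrt 2 * 15 powr (2 + \<beta> - \<epsilon>) * ?p)"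
      proof -
        \<comment> \<open>\<open>C\<close> is an arbitrary real, so it is replaced by its absolute
          value before monotonicity is applied.\<close>
        have "0 \<le> ?T (15 * n)" by (simp add: num_weights_def)
        then have "real t \<le> \<bar>C\<bar> * ?T (15 * n)"
          using ts(2) by (meson abs_ge_self mult_right_mono order_trans)
        also have "\<dots> \<le> \<bar>C\<bar> * (sqrt 2 * 15 powr (2 + \<beta> - \<epsilon>) * ?p)"
          unfolding \<beta>_def by (intro mult_left_mono apsp_time_le[OF assms(1) n1]) simp
        finally show ?thesis .
      qed
      ultimately show ?thesis unfolding C'_def by (simp add: algebra_simps)
    qed
    ultimately show ?thesis using run(1) unfolding W_def s0_def by blast
  qed
  then show ?thesis unfolding solvable_in_time_def by (intro exI[of _ ?P] exI[of _ "5 * c + 12"] exI[of _ C']) auto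
qed

section \<open>Transfer of hardness to larger classes of graphs\<close>

lemma solvable_in_time_subset:
  assumes "solvable_in_time inst inp correct T" "\<And>n. inst' n \<subseteq> inst n"
  shows "solvable_in_time inst' inp correct T"
  using assms(1) unfolding solvable_in_time_def
  by (elim ex_forward all_forward imp_forward) (use assms(2) in \<open>auto simp: subset_iff\<close>)

lemma apsp_solvable_subset:
  assumes "apsp_solvable_in_time \<G> T" "\<And>n. \<H> n \<subseteq> \<G> n"
  shows "apsp_solvable_in_time \<H> T"
  unfolding apsp_solvable_in_time_def
proof
  fix c
  have "solvable_in_time (\<lambda>n. {(G, w) \<in> \<G> n. \<forall>e\<in>parcs G. \<bar>w e\<bar> \<le> int n ^ c})
      apsp_input apsp_correct T"
    using assms(1) by (simp add: apsp_solvable_in_time_def)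
  then show "solvable_in_time (\<lambda>n. {(G, w) \<in> \<H> n. \<forall>e\<in>parcs G. \<bar>w e\<bar> \<le> int n ^ c})
      apsp_input apsp_correct T"
    by (rule solvable_in_time_subset) (use assms(2) in blast)
qed

lemma few_weights_subset_per_node:
  "directed_graphs n \<inter> few_weights d \<subseteq> few_weights_per_node d"
proof safe
  fix G w assume G: "(G, w) \<in> directed_graphs n" "(G, w) \<in> few_weights d"
  then interpret pair_digraph G by (simp add: directed_graphs_def)
  have "card (w ` out_arcs (with_proj G) u) \<le> card (w ` parcs G)" for u
    using pair_finite_arcs by (intro card_mono image_mono) (auto simp: out_arcs_def)
  then show "(G, w) \<in> few_weights_per_node d"
    using G(2) unfolding few_weights_def few_weights_per_node_def
    by (auto intro: order_trans[OF of_nat_mono])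
qed

theorem theorem1p6:
  fixes \<gamma> \<epsilon> :: real
  assumes "bounded_min_plus_hypothesis"
    and "0 \<le> \<gamma>" and "\<gamma> \<le> 1"
    and "\<epsilon> > 0"
  shows "\<not> apsp_solvable_in_time
            (\<lambda>n. directed_graphs n \<inter> few_weights (num_weights \<gamma> n))
            (\<lambda>n. sqrt (num_weights \<gamma> n) * real n powr (5/2 - \<epsilon>))
       \<and> \<not> apsp_solvable_in_time
            (\<lambda>n. undirected_graphs n \<inter> few_weights (num_weights \<gamma> n))
            (\<lambda>n. sqrt (num_weights \<gamma> n) * real n powr (5/2 - \<epsilon>))
       \<and> \<not> apsp_solvable_in_time
            (\<lambda>n. directed_graphs n \<inter> few_weights_per_node (num_weights \<gamma> n))
            (\<lambda>n. sqrt (num_weights \<gamma> n) * real n powr (5/2 - \<epsilon>))"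
proof -
  let ?T = "\<lambda>n. sqrt (num_weights \<gamma> n) * real n powr (5/2 - \<epsilon>)"
  let ?U = "\<lambda>n. undirected_graphs n \<inter> few_weights (num_weights \<gamma> n)"
  have U: "\<not> apsp_solvable_in_time ?U ?T"
  proof
    assume "apsp_solvable_in_time ?U ?T"
    note min_plus_solvable[OF assms(2,3) this]
    \<comment> \<open>The map from \<gamma> to \<open>(1 + \<gamma>) / 2\<close> sends
      \<open>[0, 1]\<close> into the range of exponents covered by the hypothesis.\<close>
    moreover have "(1 + \<gamma>) / 2 \<in> {1/2..1}" "0 < min \<epsilon> (1/2)" using assms by auto
    ultimately show False using assms(1) unfolding bounded_min_plus_hypothesis_def by blast
  qed
  \<comment> \<open>The undirected class is contained in the other two, so its hardness carries
    over.\<close>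
  have 1: "?U n \<subseteq> directed_graphs n \<inter> few_weights (num_weights \<gamma> n)" for n
    by (auto simp: undirected_graphs_def)
  have 2: "?U n \<subseteq> directed_graphs n \<inter> few_weights_per_node (num_weights \<gamma> n)" for n
    using 1[of n] few_weights_subset_per_node[of n "num_weights \<gamma> n"] by blast
  show ?thesis
    using U apsp_solvable_subset[where \<H> = ?U, OF _ 1] apsp_solvable_subset[where \<H> = ?U, OF _ 2]
    by auto
qed

end
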